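(* Let $\lambda\in\mathbb{R}\setminus\{-1,0\}$ and let $T\in\mathcal{B}(\mathcal{H})$ be self-adjoint with generic part $T_0$ on $\mathcal{H}_0$ with respect to $\lambda$. Suppose $\mathcal{H}_0=\mathcal{K}\oplus\mathcal{K}$ and $T_0-\frac{1+\lambda}{2}I=B\oplus(-B)$ with $B\in\mathcal{B}(\mathcal{K})$ positive and $\frac{|1-|\lambda||}{2}I<B<\frac{1+|\lambda|}{2}I$. Then $T=\lambda P+Q$ for some pair of projections $(P,Q)$. Moreover, if $\lambda=1$, $$\mathcal{T}_1=\{(0\oplus E\oplus I\oplus P_U,\ 0\oplus(I-E)\oplus I\oplus Q_U): E\in\mathcal{P}(\mathcal{N}(T-I)),\ U\in\mathcal{U}(\{B\}')\}$$ with respect to $\mathcal{H}=\mathcal{N}(T)\oplus\mathcal{N}(T-I)\oplus\mathcal{N}(T-2I)\oplus\mathcal{H}_0$, and if $\lambda\notin\{-1,0,1\}$, $$\mathcal{T}_\lambda=\{(0\oplus0\oplus I\oplus I\oplus P_U,\ 0\oplus I\oplus0\oplus I\oplus Q_U): U\in\mathcal{U}(\{B\}')\}$$ with respect to $\mathcal{H}=\mathcal{N}(T)\oplus\mathcal{N}(T-I)\oplus\mathcal{N}(T-\lambda I)\oplus\mathcal{N}(T-(1+\lambda)I)\oplus\mathcal{H}_0$.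
   Context: $\mathcal{H}$ is an infinite-dimensional complex Hilbert space; "projection" means orthogonal projection; $\mathcal{P}(\mathcal{M})$ is the set of projections on a Hilbert space $\mathcal{M}$. For self-adjoint $A,C$, $A<C$ means $C-A$ is positive and injective. For self-adjoint $T$ and $\lambda\in\mathbb{R}$, $\mathcal{H}_0$ is the orthogonal complement of $\mathcal{N}(T)+\mathcal{N}(T-I)+\mathcal{N}(T-\lambda I)+\mathcal{N}(T-(1+\lambda)I)$; it reduces $T$, and $T_0=T|_{\mathcal{H}_0}$ is the generic part of $T$ with respect to $\lambda$. $\mathcal{T}_\lambda=\{(P,Q)\in\mathcal{P}(\mathcal{H})\times\mathcal{P}(\mathcal{H}): T=\lambda P+Q\}$. $\mathcal{U}(\{B\}')$ is the set of unitaries commuting with $B$. For $U\in\mathcal{U}(\{B\}')$, define on $\mathcal{K}\oplus\mathcal{K}$ $$P_U=\frac{1}{2\lambda}\begin{pmatrix}P_{11}&P_{12}U\\ U^*P_{12}&P_{22}\end{pmatrix},\qquad Q_U=\frac12\begin{pmatrix}Q_{11}&Q_{12}U\\ U^*Q_{12}&Q_{22}\end{pmatrix},$$ where, if $\lambda\neq1$: $P_{11}=B^{-1}(B+\frac{1+\lambda}{2}I)(B-\frac{1-\lambda}{2}I)$, $P_{22}=-B^{-1}(B-\frac{1+\lambda}{2}I)(B+\frac{1-\lambda}{2}I)$, $Q_{11}=B^{-1}(B+\frac{1+\lambda}{2}I)(B+\frac{1-\lambda}{2}I)$, $Q_{22}=-B^{-1}(B-\frac{1+\lambda}{2}I)(B-\frac{1-\lambda}{2}I)$,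 $P_{12}=B^{-1}\big[-(B^2-\frac{(1+\lambda)^2}{4}I)(B^2-\frac{(1-\lambda)^2}{4}I)\big]^{1/2}$, $Q_{12}=-P_{12}$; and if $\lambda=1$: $P_{11}=Q_{11}=B+I$, $P_{22}=Q_{22}=I-B$, $P_{12}=(I-B^2)^{1/2}$, $Q_{12}=-P_{12}$. *)

theory Defs
  imports "HOL-Analysis.Analysis"
begin

class complex_vector = ab_group_add +
  fixes scaleC :: "complex \<Rightarrow> 'a \<Rightarrow> 'a" (infixr \<open>*\<^sub>C\<close> 75)
  assumes scaleC_add_right: "a *\<^sub>C (x + y) = a *\<^sub>C x + a *\<^sub>C y"
    and scaleC_add_left: "(a + b) *\<^sub>C x = a *\<^sub>C x + b *\<^sub>C x"
    and scaleC_scaleC: "a *\<^sub>C (b *\<^sub>C x) = (a * b) *\<^sub>C x"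
    and scaleC_one: "1 *\<^sub>C x = x"

class chilbert_space = complex_vector +
  fixes cinner :: "'a \<Rightarrow> 'a \<Rightarrow> complex"
  assumes cinner_conj: "cinner x y = cnj (cinner y x)"
    and cinner_add_left: "cinner (x + y) z = cinner x z + cinner y z"
    and cinner_scaleC_left: "cinner (a *\<^sub>C x) y = cnj a * cinner x y"
    and cinner_nonneg: "0 \<le> Re (cinner x x)"
    and cinner_eq_zero: "cinner x x = 0 \<Longrightarrow> x = 0"
    and cinner_complete:
      "(\<forall>e>0. \<exists>N::nat. \<forall>m\<ge>N. \<forall>n\<ge>N. sqrt (Re (cinner (X m - X n) (X m - X n))) < e)
        \<Longrightarrow> \<exists>L. \<forall>e>0. \<exists>N::nat. \<forall>n\<ge>N. sqrt (Re (cinner (X n - L) (X n - L))) < e"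

definition cnorm :: "'a::chilbert_space \<Rightarrow> real" where
  "cnorm x = sqrt (Re (cinner x x))"

definition cspan :: "'a::complex_vector set \<Rightarrow> 'a set" where
  "cspan F = {x. \<exists>G c. finite G \<and> G \<subseteq> F \<and> x = (\<Sum>g\<in>G. c g *\<^sub>C g)}"

definition infinite_dimensional :: "'a::complex_vector itself \<Rightarrow> bool" where
  "infinite_dimensional _ \<longleftrightarrow> \<not> (\<exists>F::'a set. finite F \<and> cspan F = UNIV)"

definition clinear :: "('a::complex_vector \<Rightarrow> 'b::complex_vector) \<Rightarrow> bool" where
  "clinear f \<longleftrightarrow> (\<forall>x y. f (x + y) = f x + f y) \<and> (\<forall>a x. f (a *\<^sub>C x) = a *\<^sub>C f x)"

definition bounded_op :: "('a::chilbert_space \<Rightarrow> 'b::chilbert_space) \<Rightarrow> bool" where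
  "bounded_op f \<longleftrightarrow> clinear f \<and> (\<exists>K. \<forall>x. cnorm (f x) \<le> K * cnorm x)"

definition adjoint :: "('a::chilbert_space \<Rightarrow> 'b::chilbert_space) \<Rightarrow> ('b \<Rightarrow> 'a)" where
  "adjoint A = (THE S. \<forall>x y. cinner (A x) y = cinner x (S y))"

definition selfadjoint :: "('a::chilbert_space \<Rightarrow> 'a) \<Rightarrow> bool" where
  "selfadjoint A \<longleftrightarrow> bounded_op A \<and> (\<forall>x y. cinner (A x) y = cinner x (A y))"

definition is_projection :: "('a::chilbert_space \<Rightarrow> 'a) \<Rightarrow> bool" where
  "is_projection P \<longleftrightarrow> selfadjoint P \<and> P \<circ> P = P"

definition positive_op :: "('a::chilbert_space \<Rightarrow> 'a) \<Rightarrow> bool" where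
  "positive_op A \<longleftrightarrow> bounded_op A \<and> (\<forall>x. Im (cinner x (A x)) = 0 \<and> 0 \<le> Re (cinner x (A x)))"

definition op_less :: "('a::chilbert_space \<Rightarrow> 'a) \<Rightarrow> ('a \<Rightarrow> 'a) \<Rightarrow> bool" where
  "op_less A C \<longleftrightarrow> positive_op (\<lambda>x. C x - A x) \<and> inj (\<lambda>x. C x - A x)"

definition scal_op :: "real \<Rightarrow> 'a::complex_vector \<Rightarrow> 'a" where
  "scal_op r = (\<lambda>x. complex_of_real r *\<^sub>C x)"

definition shift :: "('a::complex_vector \<Rightarrow> 'a) \<Rightarrow> real \<Rightarrow> 'a \<Rightarrow> 'a" where
  "shift A r = (\<lambda>x. A x - complex_of_real r *\<^sub>C x)"

definition op_inverse :: "('a::chilbert_space \<Rightarrow> 'a) \<Rightarrow> ('a \<Rightarrow> 'a)" where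
  "op_inverse A = (THE S. bounded_op S \<and> S \<circ> A = id \<and> A \<circ> S = id)"

definition op_sqrt :: "('a::chilbert_space \<Rightarrow> 'a) \<Rightarrow> ('a \<Rightarrow> 'a)" where
  "op_sqrt A = (THE S. positive_op S \<and> S \<circ> S = A)"

definition unitary :: "('a::chilbert_space \<Rightarrow> 'a) \<Rightarrow> bool" where
  "unitary U \<longleftrightarrow> bounded_op U \<and> (\<forall>x y. cinner (U x) (U y) = cinner x y) \<and> surj U"

definition kernel :: "('a::complex_vector \<Rightarrow> 'b::complex_vector) \<Rightarrow> 'a set" where
  "kernel A = {x. A x = 0}"

definition orth_compl :: "'a::chilbert_space set \<Rightarrow> 'a set" where
  "orth_compl S = {x. \<forall>y\<in>S. cinner y x = 0}"

definition orth_proj :: "'a::chilbert_space set \<Rightarrow> 'a \<Rightarrow> 'a" where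
  "orth_proj M x = (THE y. y \<in> M \<and> (\<forall>m\<in>M. cinner m (x - y) = 0))"

definition generic_space :: "('a::chilbert_space \<Rightarrow> 'a) \<Rightarrow> real \<Rightarrow> 'a set" where
  "generic_space T lam = orth_compl
     {a + b + c + d | a b c d. a \<in> kernel T \<and> b \<in> kernel (shift T 1)
        \<and> c \<in> kernel (shift T lam) \<and> d \<in> kernel (shift T (1 + lam))}"

definition W_op :: "('b::chilbert_space \<Rightarrow> 'a::chilbert_space) \<Rightarrow> ('b \<Rightarrow> 'a) \<Rightarrow> 'b \<times> 'b \<Rightarrow> 'a" where
  "W_op J1 J2 = (\<lambda>(k1, k2). J1 k1 + J2 k2)"

definition W_adj :: "('b::chilbert_space \<Rightarrow> 'a::chilbert_space) \<Rightarrow> ('b \<Rightarrow> 'a) \<Rightarrow> 'a \<Rightarrow> 'b \<times> 'b" where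
  "W_adj J1 J2 = (\<lambda>x. (adjoint J1 x, adjoint J2 x))"

definition unitary_sum_onto :: "('b::chilbert_space \<Rightarrow> 'a::chilbert_space) \<Rightarrow> ('b \<Rightarrow> 'a) \<Rightarrow> 'a set \<Rightarrow> bool" where
  "unitary_sum_onto J1 J2 M \<longleftrightarrow>
     clinear J1 \<and> clinear J2 \<and>
     (\<forall>x y. cinner (J1 x) (J1 y) = cinner x y) \<and>
     (\<forall>x y. cinner (J2 x) (J2 y) = cinner x y) \<and>
     (\<forall>x y. cinner (J1 x) (J2 y) = 0) \<and>
     range (W_op J1 J2) = M"

definition block_op :: "('b::complex_vector \<Rightarrow> 'b) \<Rightarrow> ('b \<Rightarrow> 'b) \<Rightarrow> ('b \<Rightarrow> 'b) \<Rightarrow> ('b \<Rightarrow> 'b)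
    \<Rightarrow> 'b \<times> 'b \<Rightarrow> 'b \<times> 'b" where
  "block_op M11 M12 M21 M22 = (\<lambda>(k1, k2). (M11 k1 + M12 k2, M21 k1 + M22 k2))"

definition neg_op :: "('b::complex_vector \<Rightarrow> 'b) \<Rightarrow> 'b \<Rightarrow> 'b" where
  "neg_op A = (\<lambda>x. - A x)"

definition P11 :: "real \<Rightarrow> ('b::chilbert_space \<Rightarrow> 'b) \<Rightarrow> 'b \<Rightarrow> 'b" where
  "P11 lam B = (if lam = 1 then shift B (-1)
     else op_inverse B \<circ> shift B (- (1 + lam) / 2) \<circ> shift B ((1 - lam) / 2))"

definition P22 :: "real \<Rightarrow> ('b::chilbert_space \<Rightarrow> 'b) \<Rightarrow> 'b \<Rightarrow> 'b" where
  "P22 lam B = (if lam = 1 then (\<lambda>x. x - B x)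
     else neg_op (op_inverse B \<circ> shift B ((1 + lam) / 2) \<circ> shift B (- (1 - lam) / 2)))"

definition Q11 :: "real \<Rightarrow> ('b::chilbert_space \<Rightarrow> 'b) \<Rightarrow> 'b \<Rightarrow> 'b" where
  "Q11 lam B = (if lam = 1 then shift B (-1)
     else op_inverse B \<circ> shift B (- (1 + lam) / 2) \<circ> shift B (- (1 - lam) / 2))"

definition Q22 :: "real \<Rightarrow> ('b::chilbert_space \<Rightarrow> 'b) \<Rightarrow> 'b \<Rightarrow> 'b" where
  "Q22 lam B = (if lam = 1 then (\<lambda>x. x - B x)
     else neg_op (op_inverse B \<circ> shift B ((1 + lam) / 2) \<circ> shift B ((1 - lam) / 2)))"

definition P12 :: "real \<Rightarrow> ('b::chilbert_space \<Rightarrow> 'b) \<Rightarrow> 'b \<Rightarrow> 'b" where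
  "P12 lam B = (if lam = 1 then op_sqrt (\<lambda>x. x - B (B x))
     else op_inverse B \<circ> op_sqrt (neg_op (shift (B \<circ> B) (((1 + lam) / 2)\<^sup>2)
                                          \<circ> shift (B \<circ> B) (((1 - lam) / 2)\<^sup>2))))"

definition Q12 :: "real \<Rightarrow> ('b::chilbert_space \<Rightarrow> 'b) \<Rightarrow> 'b \<Rightarrow> 'b" where
  "Q12 lam B = neg_op (P12 lam B)"

definition P_U :: "real \<Rightarrow> ('b::chilbert_space \<Rightarrow> 'b) \<Rightarrow> ('b \<Rightarrow> 'b) \<Rightarrow> 'b \<times> 'b \<Rightarrow> 'b \<times> 'b" where
  "P_U lam B U = (\<lambda>k. (\<lambda>(a, b). (complex_of_real (1 / (2 * lam)) *\<^sub>C a,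
                                   complex_of_real (1 / (2 * lam)) *\<^sub>C b))
       (block_op (P11 lam B) (P12 lam B \<circ> U) (adjoint U \<circ> P12 lam B) (P22 lam B) k))"

definition Q_U :: "real \<Rightarrow> ('b::chilbert_space \<Rightarrow> 'b) \<Rightarrow> ('b \<Rightarrow> 'b) \<Rightarrow> 'b \<times> 'b \<Rightarrow> 'b \<times> 'b" where
  "Q_U lam B U = (\<lambda>k. (\<lambda>(a, b). (complex_of_real (1 / 2) *\<^sub>C a, complex_of_real (1 / 2) *\<^sub>C b))
       (block_op (Q11 lam B) (Q12 lam B \<circ> U) (adjoint U \<circ> Q12 lam B) (Q22 lam B) k))"

definition T_pairs :: "('a::chilbert_space \<Rightarrow> 'a) \<Rightarrow> real \<Rightarrow> (('a \<Rightarrow> 'a) \<times> ('a \<Rightarrow> 'a)) set" where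
  "T_pairs T lam = {(P, Q). is_projection P \<and> is_projection Q \<and>
                            T = (\<lambda>x. complex_of_real lam *\<^sub>C P x + Q x)}"

end

theory Submission
  imports Defs
begin

text \<open>Put \<open>S = T - (1 + lam) / 2\<close> and, for a pair \<open>(P, Q)\<close> with \<open>T = lam P + Q\<close>,
  \<open>G = 2 lam P - lam - S\<close>. The equations \<open>P\<^sup>2 = P\<close> and \<open>Q\<^sup>2 = Q\<close> are equivalent to
  \<open>S G + G S = (lam\<^sup>2 - 1) / 2\<close> and \<open>S\<^sup>2 + G\<^sup>2 = (lam\<^sup>2 + 1) / 2\<close>. On the generic part
  \<open>S = B \<oplus> (- B)\<close>, so the first equation forces the diagonal of \<open>G\<close> to be \<open>F \<oplus> (- F)\<close> with
  \<open>F = (lam\<^sup>2 - 1) / 4 B\<inverse>\<close> and its off-diagonal entry \<open>C\<close> to commute with \<open>B\<close>; the second one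
  says that \<open>C\<close> is normal with \<open>C C\<^sup>* = (lam\<^sup>2 + 1) / 2 - B\<^sup>2 - F\<^sup>2 = P\<^sub>1\<^sub>2\<^sup>2\<close>. As \<open>P\<^sub>1\<^sub>2\<close> is
  injective, the polar decomposition of \<open>C\<close> gives the unitary \<open>U\<close>. On the eigenspaces \<open>P\<close> and
  \<open>Q\<close> are determined by the fact that \<open>mu P x + Q x = 0\<close> implies \<open>P x = Q x = 0\<close> unless
  \<open>mu\<close> is \<open>0\<close> or \<open>-1\<close>.\<close>

subsection \<open>Inner product, limits and bounded operators\<close>

text \<open>\<open>S\<close> and \<open>G\<close> are the sum and the difference of
  \<open>lam (P - 1/2)\<close> and \<open>Q - 1/2\<close>, whose squares are the scalars
  \<open>lam^2 / 4\<close> and \<open>1/4\<close>; this is the source of both equations and of their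
  constants. On the diagonal the first one is a Sylvester equation for \<open>B\<close>. Its
  homogeneous version is settled by a square root: an operator that anticommutes with
  \<open>B\<close> commutes with \<open>B^2\<close>, hence with the positive root \<open>B\<close>.
  Square roots are therefore built together with the statement that they commute with everything
  commuting with the radicand. The obstacle is that the strict inequalities give injectivity but no
  positive lower bound: the inverse of \<open>P12\<close> may be unbounded, and for
  \<open>lam = 1\<close> so may that of \<open>B\<close>. Hence \<open>U\<close> is not formed with
  a bounded inverse of \<open>P12\<close> but as a limit along its dense range, and for
  \<open>lam = 1\<close> all formulas have to do without the inverse of \<open>B\<close>.\<close>

interpretation cv: vector_space "scaleC :: complex \<Rightarrow> 'a::complex_vector \<Rightarrow> 'a"
  by unfold_locales (simp_all add: scaleC_add_right scaleC_add_left scaleC_scaleC scaleC_one)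

section \<open>Algebra of the inner product and the induced norm\<close>

lemma cinner_add_right: "cinner x (y + z) = cinner x y + cinner x (z::'a::chilbert_space)"
  by (metis cinner_add_left cinner_conj complex_cnj_add)

lemma cinner_scaleC_right: "cinner x (a *\<^sub>C y) = a * cinner x (y::'a::chilbert_space)"
  by (metis cinner_conj cinner_scaleC_left complex_cnj_cnj complex_cnj_mult)

lemma cinner_zero_left [simp]: "cinner 0 (y::'a::chilbert_space) = 0"
  using cinner_scaleC_left[of 0 0 y] by simp

lemma cinner_zero_right [simp]: "cinner (y::'a::chilbert_space) 0 = 0"
  using cinner_scaleC_right[of y 0 0] by simp

lemma cinner_minus_left: "cinner (- x) (y::'a::chilbert_space) = - cinner x y"
  using cinner_scaleC_left[of "-1" x y] by simp

lemma cinner_minus_right: "cinner x (- y::'a::chilbert_space) = - cinner x y"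
  using cinner_scaleC_right[of x "-1" y] by simp

lemma cinner_diff_left: "cinner (x - y) (z::'a::chilbert_space) = cinner x z - cinner y z"
  using cinner_add_left[of x "- y" z] by (simp add: cinner_minus_left)

lemma cinner_diff_right: "cinner x (y - z::'a::chilbert_space) = cinner x y - cinner x z"
  using cinner_add_right[of x y "- z"] by (simp add: cinner_minus_right)

lemmas cinner_simps = cinner_add_left cinner_add_right cinner_scaleC_left cinner_scaleC_right
  cinner_minus_left cinner_minus_right cinner_diff_left cinner_diff_right

text \<open>Besides separating vectors, this turns an identity between linear combinations of
  vectors into one between complex numbers, where \<open>field_simps\<close> and
  \<open>algebra_simps\<close> apply. Many operator identities below are verified in this
  way.\<close>

lemma cinner_ext:
  assumes "\<And>z. cinner z u = cinner z (v::'a::chilbert_space)"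
  shows "u = v"
  using assms[of "u - v"] cinner_eq_zero[of "u - v"] by (simp add: cinner_simps)

lemma Im_cinner_self [simp]: "Im (cinner x (x::'a::chilbert_space)) = 0"
  using arg_cong[OF cinner_conj[of x x], of Im] by simp

lemma cnorm_sq: "(cnorm x)\<^sup>2 = Re (cinner x (x::'a::chilbert_space))"
  by (simp add: cnorm_def cinner_nonneg)

lemma cinner_self: "cinner x x = complex_of_real ((cnorm (x::'a::chilbert_space))\<^sup>2)"
  by (simp add: complex_eq_iff cnorm_sq)

lemma cnorm_ge_0 [simp]: "0 \<le> cnorm (x::'a::chilbert_space)"
  by (simp add: cnorm_def cinner_nonneg)

lemma cnorm_zero [simp]: "cnorm (0::'a::chilbert_space) = 0"
  by (simp add: cnorm_def)

lemma cnorm_eq_0 [simp]: "cnorm x = 0 \<longleftrightarrow> x = (0::'a::chilbert_space)"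
  using cinner_self[of x] cinner_eq_zero[of x] by auto

lemma cnorm_scaleC: "cnorm (a *\<^sub>C x) = cmod a * cnorm (x::'a::chilbert_space)"
proof -
  have "(cnorm (a *\<^sub>C x))\<^sup>2 = (cmod a * cnorm x)\<^sup>2"
    unfolding power_mult_distrib cnorm_sq
    by (simp only: cmod_power2) (simp add: cinner_simps algebra_simps power2_eq_square)
  then show ?thesis by (simp add: power2_eq_iff_nonneg)
qed

lemma cnorm_minus [simp]: "cnorm (- x) = cnorm (x::'a::chilbert_space)"
  using cnorm_scaleC[of "-1" x] by simp

lemma cnorm_minus_commute: "cnorm (x - y) = cnorm (y - x::'a::chilbert_space)"
  using cnorm_minus[of "x - y"] by simp

lemma cinner_cauchy_schwarz: "cmod (cinner x y) \<le> cnorm x * cnorm (y::'a::chilbert_space)"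
proof (cases "y = 0")
  case False
  define n where "n = (cnorm y)\<^sup>2"
  have n: "n > 0" "cinner y y = complex_of_real n"
    using False by (auto simp: n_def cinner_self[symmetric] zero_less_power2)
      (simp add: cinner_self)
  \<comment> \<open>With this coefficient, \<open>t\<close> times \<open>y\<close> is the projection
    of \<open>x\<close> onto the line through \<open>y\<close>, so the remainder has the least
    norm.\<close>
  define t where "t = cinner y x / cinner y y"
  have "0 \<le> Re (cinner (x - t *\<^sub>C y) (x - t *\<^sub>C y))" by (rule cinner_nonneg)
  also have "cinner (x - t *\<^sub>C y) (x - t *\<^sub>C y)
      = cinner x x - cinner x y * cinner y x / complex_of_real n"
    using n cinner_conj[of x y] by (simp add: cinner_simps t_def field_simps)
  also have "cinner x y * cinner y x = complex_of_real ((cmod (cinner x y))\<^sup>2)"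
    using cinner_conj[of y x] by (simp only: complex_norm_square)
  finally have "(cmod (cinner x y))\<^sup>2 / n \<le> (cnorm x)\<^sup>2"
    by (simp add: cnorm_sq flip: of_real_divide of_real_power)
  then have "(cmod (cinner x y))\<^sup>2 \<le> (cnorm x * cnorm y)\<^sup>2"
    using n by (simp add: n_def[symmetric] field_simps)
  then show ?thesis by (rule power2_le_imp_le) simp
qed simp

lemma cnorm_add_sq: "(cnorm (x + y))\<^sup>2 = (cnorm x)\<^sup>2 + 2 * Re (cinner x y) + (cnorm (y::'a::chilbert_space))\<^sup>2"
  using cinner_conj[of x y] by (simp add: cnorm_sq cinner_simps)

lemma cnorm_triangle: "cnorm (x + y) \<le> cnorm x + cnorm (y::'a::chilbert_space)"
proof (rule power2_le_imp_le)
  have "Re (cinner x y) \<le> cnorm x * cnorm y"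
    using cinner_cauchy_schwarz[of x y] complex_Re_le_cmod[of "cinner x y"] by linarith
  then show "(cnorm (x + y))\<^sup>2 \<le> (cnorm x + cnorm y)\<^sup>2"
    by (simp add: cnorm_add_sq power2_sum)
qed simp

lemma cnorm_triangle_diff: "cnorm (x - z) \<le> cnorm (x - y) + cnorm (y - z::'a::chilbert_space)"
  using cnorm_triangle[of "x - y" "y - z"] by simp

lemma cnorm_parallelogram:
  "(cnorm (x + y))\<^sup>2 + (cnorm (x - y))\<^sup>2 = 2 * (cnorm x)\<^sup>2 + 2 * (cnorm (y::'a::chilbert_space))\<^sup>2"
  by (simp add: cnorm_sq cinner_simps)

text \<open>The class carries no topology, so convergence in norm is encoded by a real null sequence
  and the limit rules for real sequences do the work.\<close>

definition ctendsto :: "(nat \<Rightarrow> 'a::chilbert_space) \<Rightarrow> 'a \<Rightarrow> bool" where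
  "ctendsto X L \<longleftrightarrow> (\<lambda>n. cnorm (X n - L)) \<longlonglongrightarrow> 0"

lemma null_if_bounded:
  fixes f :: "nat \<Rightarrow> 'b::real_normed_vector"
  assumes "\<And>n. norm (f n) \<le> g n" "g \<longlonglongrightarrow> 0"
  shows "f \<longlonglongrightarrow> 0"
  by (rule Lim_null_comparison[OF always_eventually assms(2)]) (simp add: assms(1))

lemma ctendstoI:
  assumes "\<And>n. cnorm (X n - L) \<le> g n" "g \<longlonglongrightarrow> 0"
  shows "ctendsto X L"
  unfolding ctendsto_def by (rule null_if_bounded[of _ g]) (use assms in auto)

lemma ctendsto_complete:
  fixes X :: "nat \<Rightarrow> 'a::chilbert_space"
  assumes "\<And>e. e > 0 \<Longrightarrow> \<exists>N. \<forall>m\<ge>N. \<forall>n\<ge>N. cnorm (X m - X n) < e"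
  obtains L where "ctendsto X L"
proof -
  obtain L where "\<forall>e>0. \<exists>N. \<forall>n\<ge>N. cnorm (X n - L) < e"
    using cinner_complete[of X] assms unfolding cnorm_def[symmetric] by metis
  then show ?thesis by (intro that) (simp add: ctendsto_def LIMSEQ_iff)
qed

lemma ctendsto_const [simp]: "ctendsto (\<lambda>_. x) x"
  by (simp add: ctendsto_def)

lemma ctendsto_cinner:
  assumes "ctendsto X L"
  shows "(\<lambda>n. cinner z (X n)) \<longlonglongrightarrow> cinner z L"
proof -
  have "(\<lambda>n. cnorm z * cnorm (X n - L)) \<longlonglongrightarrow> cnorm z * 0"
    using assms unfolding ctendsto_def by (intro tendsto_intros)
  then have "(\<lambda>n. cinner z (X n) - cinner z L) \<longlonglongrightarrow> 0"
    by - (rule null_if_bounded[of _ "\<lambda>n. cnorm z * cnorm (X n - L)"],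
      simp_all add: cinner_diff_right[symmetric] cinner_cauchy_schwarz)
  then show ?thesis by (simp add: LIM_zero_iff)
qed

lemma ctendsto_cnorm:
  assumes "ctendsto X L"
  shows "(\<lambda>n. cnorm (X n)) \<longlonglongrightarrow> cnorm L"
proof -
  have "norm (cnorm (X n) - cnorm L) \<le> cnorm (X n - L)" for n
    using cnorm_triangle[of "X n - L" L] cnorm_triangle[of "L - X n" "X n"]
      cnorm_minus_commute[of L "X n"] by simp
  then have "(\<lambda>n. cnorm (X n) - cnorm L) \<longlonglongrightarrow> 0"
    using assms unfolding ctendsto_def by (rule null_if_bounded)
  then show ?thesis by (simp add: LIM_zero_iff)
qed

lemma ctendsto_unique:
  assumes "ctendsto X L" "ctendsto X M"
  shows "L = M"
  by (rule cinner_ext) (rule LIMSEQ_unique[OF ctendsto_cinner[OF assms(1)] ctendsto_cinner[OF assms(2)]])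

lemma ctendsto_add:
  assumes "ctendsto X L" "ctendsto Y M"
  shows "ctendsto (\<lambda>n. X n + Y n) (L + M)"
proof -
  have "cnorm (X n + Y n - (L + M)) \<le> cnorm (X n - L) + cnorm (Y n - M)" for n
    using cnorm_triangle[of "X n - L" "Y n - M"] by (simp add: algebra_simps)
  moreover have "(\<lambda>n. cnorm (X n - L) + cnorm (Y n - M)) \<longlonglongrightarrow> 0 + 0"
    using assms unfolding ctendsto_def by (intro tendsto_intros)
  ultimately show ?thesis by - (rule ctendstoI, assumption, simp)
qed

section \<open>Linear maps and bounded operators\<close>

lemma clinear_add: "clinear f \<Longrightarrow> f (x + y) = f x + f y"
  and clinear_scaleC: "clinear f \<Longrightarrow> f (a *\<^sub>C x) = a *\<^sub>C f x"
  by (auto simp: clinear_def)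

lemma clinear_zero: "clinear f \<Longrightarrow> f 0 = 0"
  by (metis clinear_scaleC cv.scale_zero_left)

lemma clinear_minus: "clinear f \<Longrightarrow> f (- x) = - f x"
  using clinear_scaleC[of f "-1" x] by simp

lemma clinear_diff: "clinear f \<Longrightarrow> f (x - y) = f x - f y"
  using clinear_add[of f x "- y"] by (simp add: clinear_minus)

lemmas clinear_simps = clinear_add clinear_scaleC clinear_zero clinear_minus clinear_diff

lemma bounded_op_clinear: "bounded_op f \<Longrightarrow> clinear f"
  by (simp add: bounded_op_def)

lemma bounded_op_bound:
  assumes "bounded_op f"
  obtains K where "K > 0" "\<And>x. cnorm (f x) \<le> K * cnorm x"
proof -
  obtain K where K: "\<And>x. cnorm (f x) \<le> K * cnorm x"
    using assms by (auto simp: bounded_op_def)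
  \<comment> \<open>The bound in \<open>bounded_op\<close> may be zero, or even negative on a
    trivial space; enlarging it makes it usable as a divisor.\<close>
  have "cnorm (f x) \<le> (max 1 K) * cnorm x" for x
    using K[of x] mult_right_mono[of K "max 1 K" "cnorm x"] by simp
  then show ?thesis using that[of "max 1 K"] by simp
qed

lemma bounded_opI:
  assumes "clinear f" "\<And>x. cnorm (f x) \<le> K * cnorm x"
  shows "bounded_op f"
  using assms by (auto simp: bounded_op_def)

lemma bounded_op_id [simp]: "bounded_op (\<lambda>x. x)"
  by (rule bounded_opI[of _ 1]) (auto simp: clinear_def)

lemma bounded_op_zero [simp]: "bounded_op (\<lambda>x. 0)"
  by (rule bounded_opI[of _ 1]) (auto simp: clinear_def)

lemma bounded_op_add:
  assumes "bounded_op f" "bounded_op g"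
  shows "bounded_op (\<lambda>x. f x + g x)"
proof -
  obtain K M where K: "\<And>x. cnorm (f x) \<le> K * cnorm x" and M: "\<And>x. cnorm (g x) \<le> M * cnorm x"
    using bounded_op_bound assms by metis
  then have "cnorm (f x + g x) \<le> (K + M) * cnorm x" for x
    using cnorm_triangle[of "f x" "g x"] add_mono[OF K[of x] M[of x]] by (simp add: distrib_right)
  then show ?thesis
    using assms by (intro bounded_opI[where K = "K + M"])
      (simp_all add: clinear_def bounded_op_def scaleC_add_right add.assoc add.left_commute)
qed

lemma bounded_op_compose:
  assumes "bounded_op f" "bounded_op g"
  shows "bounded_op (\<lambda>x. f (g x))"
proof -
  obtain K M where K: "K > 0" "\<And>x. cnorm (f x) \<le> K * cnorm x" and M: "\<And>x. cnorm (g x) \<le> M * cnorm x"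
    using bounded_op_bound assms by metis
  have "cnorm (f (g x)) \<le> (K * M) * cnorm x" for x
    using order_trans[OF K(2)[of "g x"] mult_left_mono[OF M[of x], of K]] K(1) by (simp add: mult.assoc)
  then show ?thesis
    using assms by (intro bounded_opI[where K = "K * M"]) (simp_all add: clinear_def bounded_op_def)
qed

lemma bounded_op_scaleC:
  assumes "bounded_op f"
  shows "bounded_op (\<lambda>x. a *\<^sub>C f x)"
proof -
  have "bounded_op (\<lambda>x::'b. a *\<^sub>C x)"
    by (rule bounded_opI[of _ "cmod a"]) (auto simp: clinear_def cnorm_scaleC scaleC_add_right mult.commute)
  then show ?thesis using bounded_op_compose assms by blast
qed

lemma bounded_op_minus: "bounded_op f \<Longrightarrow> bounded_op (\<lambda>x. - f x)"
  using bounded_op_scaleC[of f "-1"] by simp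

lemma bounded_op_diff: "bounded_op f \<Longrightarrow> bounded_op g \<Longrightarrow> bounded_op (\<lambda>x. f x - g x)"
  using bounded_op_add[of f "\<lambda>x. - g x"] by (simp add: bounded_op_minus)

lemmas bounded_op_intros = bounded_op_id bounded_op_zero bounded_op_add
  bounded_op_scaleC bounded_op_minus bounded_op_diff

lemma ctendsto_bounded_op:
  assumes "bounded_op f" "ctendsto X L"
  shows "ctendsto (\<lambda>n. f (X n)) (f L)"
proof -
  obtain K where K: "\<And>x. cnorm (f x) \<le> K * cnorm x"
    using bounded_op_bound assms by metis
  have "(\<lambda>n. K * cnorm (X n - L)) \<longlonglongrightarrow> K * 0"
    using assms unfolding ctendsto_def by (intro tendsto_intros)
  moreover have "cnorm (f (X n) - f L) \<le> K * cnorm (X n - L)" for n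
    using K[of "X n - L"] assms by (simp add: bounded_op_clinear clinear_diff)
  ultimately show ?thesis by - (rule ctendstoI, assumption, simp)
qed

lemma ctendsto_diff:
  assumes "ctendsto X L" "ctendsto Y M"
  shows "ctendsto (\<lambda>n. X n - Y n) (L - M)"
  using ctendsto_add[OF assms(1) ctendsto_bounded_op[OF bounded_op_minus[OF bounded_op_id] assms(2)]]
  by simp

subsection \<open>Orthogonal projections\<close>

definition csubspace :: "'a::complex_vector set \<Rightarrow> bool" where
  "csubspace M \<longleftrightarrow> 0 \<in> M \<and> (\<forall>x\<in>M. \<forall>y\<in>M. x + y \<in> M) \<and> (\<forall>a. \<forall>x\<in>M. a *\<^sub>C x \<in> M)"

definition cclosed :: "'a::chilbert_space set \<Rightarrow> bool" where
  "cclosed M \<longleftrightarrow> (\<forall>X L. (\<forall>n. X n \<in> M) \<longrightarrow> ctendsto X L \<longrightarrow> L \<in> M)"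

lemma csubspace_diff: "csubspace M \<Longrightarrow> x \<in> M \<Longrightarrow> y \<in> M \<Longrightarrow> x - y \<in> M"
  unfolding csubspace_def
  by (metis cv.scale_minus_left cv.scale_one diff_conv_add_uminus)

text \<open>Moving from \<open>u\<close> by the projection of \<open>u\<close> onto the line through
  \<open>m\<close> lowers the squared norm by \<open>|<m, u>|^2 / |m|^2\<close>, which minimality
  forbids unless it is zero.\<close>

lemma orthogonal_if_minimal:
  fixes u :: "'a::chilbert_space"
  assumes "csubspace M" "\<And>m. m \<in> M \<Longrightarrow> cnorm u \<le> cnorm (u - m)" "m \<in> M"
  shows "cinner m u = 0"
proof (rule ccontr)
  assume ne: "cinner m u \<noteq> 0"
  then have m0: "cnorm m > 0" by (metis cinner_zero_left cnorm_eq_0 cnorm_ge_0 order_le_less)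
  define t where "t = cinner m u / complex_of_real ((cnorm m)\<^sup>2)"
  have "cinner (u - t *\<^sub>C m) (u - t *\<^sub>C m) = cinner u u - cinner u m * cinner m u / complex_of_real ((cnorm m)\<^sup>2)"
    using m0 cinner_conj[of u m] cinner_self[of m]
    by (simp add: cinner_simps t_def field_simps power2_eq_square)
  also have "cinner u m * cinner m u = complex_of_real ((cmod (cinner m u))\<^sup>2)"
    using cinner_conj[of u m] by (simp only: complex_norm_square mult.commute)
  finally have "(cnorm (u - t *\<^sub>C m))\<^sup>2 = (cnorm u)\<^sup>2 - (cmod (cinner m u))\<^sup>2 / (cnorm m)\<^sup>2"
    by (simp add: cnorm_sq flip: of_real_divide of_real_power)
  moreover have "(cmod (cinner m u))\<^sup>2 / (cnorm m)\<^sup>2 > 0"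
    using ne by (intro divide_pos_pos zero_less_power m0) simp
  moreover have "t *\<^sub>C m \<in> M" using assms by (auto simp: csubspace_def)
  then have "(cnorm u)\<^sup>2 \<le> (cnorm (u - t *\<^sub>C m))\<^sup>2"
    using assms(2) by (simp add: power_mono)
  ultimately show False by linarith
qed

text \<open>A sequence in \<open>M\<close> minimizing the distance to \<open>x\<close> is Cauchy.
  \<open>M\<close> is not assumed closed, so the limit lies only in its closure; this single
  statement yields both orthogonal projections onto closed subspaces and the density of subspaces
  with trivial complement.\<close>

lemma subspace_approximation:
  fixes x :: "'a::chilbert_space"
  assumes M: "csubspace M"
  obtains X L where "\<And>n::nat. X n \<in> M" "ctendsto X L" "\<And>m. m \<in> M \<Longrightarrow> cinner m (x - L) = 0"
proof -
  define d where "d = Inf ((\<lambda>m. cnorm (x - m)) ` M)"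
  have M0: "0 \<in> M" and bdd: "bdd_below ((\<lambda>m. cnorm (x - m)) ` M)"
    using M by (auto simp: csubspace_def intro!: bdd_belowI[of _ 0])
  have d_le: "d \<le> cnorm (x - m)" if "m \<in> M" for m
    using that bdd unfolding d_def by (simp add: cInf_lower)
  have d0: "0 \<le> d" unfolding d_def using M0 by (intro cInf_greatest) auto
  have "\<exists>m\<in>M. cnorm (x - m) < d + 1 / real (Suc n)" for n
    using cInf_lessD[of "(\<lambda>m. cnorm (x - m)) ` M" "d + 1 / real (Suc n)"] M0
    unfolding d_def by fastforce
  then obtain X where X: "\<And>n. X n \<in> M" "\<And>n. cnorm (x - X n) < d + 1 / real (Suc n)"
    by metis
  \<comment> \<open>Parallelogram law for \<open>x - X n\<close> and \<open>x - X m\<close>: the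
    midpoint of \<open>X m\<close> and \<open>X n\<close> lies in \<open>M\<close>, so the sum of
    the two vectors has norm at least \<open>2 * d\<close>.\<close>
  have cau: "(cnorm (X m - X n))\<^sup>2 \<le> 2 * (d + 1 / real (Suc m))\<^sup>2 + 2 * (d + 1 / real (Suc n))\<^sup>2 - 4 * d\<^sup>2" for m n
  proof -
    have half: "(1/2) *\<^sub>C (X m + X n) \<in> M" using M X(1) by (auto simp: csubspace_def)
    have "(x - X n) + (x - X m) = 2 *\<^sub>C (x - (1/2) *\<^sub>C (X m + X n))"
      using cv.scale_left_distrib[of 1 1 x] by (simp add: cv.scale_right_diff_distrib)
    then have "cnorm ((x - X n) + (x - X m)) = 2 * cnorm (x - (1/2) *\<^sub>C (X m + X n))"
      by (simp only: cnorm_scaleC) simp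
    then have "cnorm ((x - X n) + (x - X m)) \<ge> 2 * d" using d_le[OF half] by simp
    then have "(cnorm ((x - X n) + (x - X m)))\<^sup>2 \<ge> (2 * d)\<^sup>2" using d0 by (intro power_mono) auto
    moreover have "(cnorm (x - X m))\<^sup>2 \<le> (d + 1 / real (Suc m))\<^sup>2"
      "(cnorm (x - X n))\<^sup>2 \<le> (d + 1 / real (Suc n))\<^sup>2"
      using X(2)[of m] X(2)[of n] by (auto intro!: power_mono)
    moreover have "(x - X n) - (x - X m) = X m - X n" by simp
    ultimately show ?thesis
      using cnorm_parallelogram[of "x - X n" "x - X m"] by (simp add: power_mult_distrib)
  qed
  obtain L where L: "ctendsto X L"
  proof (rule ctendsto_complete[of X])
    fix e :: real assume e: "e > 0"
    have "(\<lambda>n. 4 * (d + 1 / real (Suc n))\<^sup>2 - 4 * d\<^sup>2) \<longlonglongrightarrow> 4 * (d + 0)\<^sup>2 - 4 * d\<^sup>2"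
      by (intro tendsto_intros LIMSEQ_Suc[OF lim_1_over_n])
    then have "\<forall>\<^sub>F n in sequentially. 4 * (d + 1 / real (Suc n))\<^sup>2 - 4 * d\<^sup>2 < e\<^sup>2"
      using e by (intro order_tendstoD) auto
    then obtain N where N: "4 * (d + 1 / real (Suc N))\<^sup>2 - 4 * d\<^sup>2 < e\<^sup>2"
      by (auto simp: eventually_sequentially)
    have "cnorm (X m - X n) < e" if "m \<ge> N" "n \<ge> N" for m n
    proof -
      have "(d + 1 / real (Suc k))\<^sup>2 \<le> (d + 1 / real (Suc N))\<^sup>2" if "k \<ge> N" for k
        using that d0 by (intro power_mono add_left_mono) (auto simp: frac_le)
      from this[of m] this[of n] that have "(cnorm (X m - X n))\<^sup>2 < e\<^sup>2"
        using cau[of m n] N by simp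
      then show ?thesis using e by (auto dest: power2_less_imp_less)
    qed
    then show "\<exists>N. \<forall>m\<ge>N. \<forall>n\<ge>N. cnorm (X m - X n) < e" by blast
  qed
  have "ctendsto (\<lambda>n. x - X n) (x - L)"
    by (intro ctendsto_diff ctendsto_const L)
  then have lim: "(\<lambda>n. cnorm (x - X n)) \<longlonglongrightarrow> cnorm (x - L)"
    by (rule ctendsto_cnorm)
  moreover have "(\<lambda>n. d + 1 / real (Suc n)) \<longlonglongrightarrow> d + 0"
    by (intro tendsto_intros LIMSEQ_Suc[OF lim_1_over_n])
  ultimately have Ld: "cnorm (x - L) \<le> d"
    using X(2) by (intro LIMSEQ_le[of _ _ "\<lambda>n. d + 1 / real (Suc n)"]) (auto intro: less_imp_le)
  have "cnorm (x - L) \<le> cnorm (x - L - m)" if "m \<in> M" for m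
  proof (rule LIMSEQ_le_const)
    have "ctendsto (\<lambda>n. x - (X n + m)) (x - (L + m))"
      by (intro ctendsto_diff ctendsto_add ctendsto_const L)
    then have "(\<lambda>n. cnorm (x - (X n + m))) \<longlonglongrightarrow> cnorm (x - (L + m))"
      by (rule ctendsto_cnorm)
    then show "(\<lambda>n. cnorm (x - (X n + m))) \<longlonglongrightarrow> cnorm (x - L - m)"
      by (simp only: diff_diff_eq)
    show "\<exists>N. \<forall>n\<ge>N. cnorm (x - L) \<le> cnorm (x - (X n + m))"
      using order_trans[OF Ld d_le[of "X _ + m"]] X(1) that M by (simp add: csubspace_def)
  qed
  then have "cinner m (x - L) = 0" if "m \<in> M" for m
    using that by (rule orthogonal_if_minimal[OF M])
  then show ?thesis by (rule that[OF X(1) L])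
qed

text \<open>To be applied to the range of an injective self-adjoint operator, whose orthogonal
  complement is the kernel.\<close>

lemma dense_if_orthogonal_trivial:
  assumes "csubspace M" "\<And>x. (\<And>m. m \<in> M \<Longrightarrow> cinner m x = 0) \<Longrightarrow> x = 0"
  shows "\<exists>X. (\<forall>n. X n \<in> M) \<and> ctendsto X x"
proof -
  obtain X L where X: "\<And>n::nat. X n \<in> M" "ctendsto X L" "\<And>m. m \<in> M \<Longrightarrow> cinner m (x - L) = 0"
    using subspace_approximation[OF assms(1)] by metis
  from X(3) have "x - L = 0" by (rule assms(2))
  then have "ctendsto X x" using X(2) by simp
  then show ?thesis using X(1) by (intro exI[of _ X] conjI allI)
qed

text \<open>Two candidates differ by a vector of \<open>M\<close> that is orthogonal to
  \<open>M\<close>, hence to itself. This resolves the definite description in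
  \<open>orth_proj\<close> whenever a candidate is at hand.\<close>

lemma orth_proj_eqI:
  assumes "csubspace M" "y \<in> M" "\<And>m. m \<in> M \<Longrightarrow> cinner m (x - y) = 0"
  shows "orth_proj M x = y"
  unfolding orth_proj_def
proof (rule the_equality)
  fix z assume z: "z \<in> M \<and> (\<forall>m\<in>M. cinner m (x - z) = 0)"
  have "z - y \<in> M" using csubspace_diff assms z by blast
  then have "cinner (z - y) ((x - y) - (x - z)) = 0"
    using assms z by (simp only: cinner_diff_right) simp
  then show "z = y" using cinner_eq_zero[of "z - y"] by simp
qed (use assms in auto)

lemma
  assumes "csubspace M" "cclosed M"
  shows orth_proj_in: "orth_proj M x \<in> M"
    and orth_proj_orth: "m \<in> M \<Longrightarrow> cinner m (x - orth_proj M x) = 0"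
proof -
  obtain X L where X: "\<And>n::nat. X n \<in> M" "ctendsto X L" "\<And>m. m \<in> M \<Longrightarrow> cinner m (x - L) = 0"
    using subspace_approximation[OF assms(1)] by metis
  moreover have "L \<in> M" using assms X by (auto simp: cclosed_def)
  ultimately have "orth_proj M x = L" using assms orth_proj_eqI by blast
  then show "orth_proj M x \<in> M" "m \<in> M \<Longrightarrow> cinner m (x - orth_proj M x) = 0"
    using X \<open>L \<in> M\<close> by auto
qed

lemma orth_proj_ident: "csubspace M \<Longrightarrow> y \<in> M \<Longrightarrow> orth_proj M y = y"
  by (rule orth_proj_eqI) auto

lemma orth_proj_orthogonal: "csubspace M \<Longrightarrow> (\<And>m. m \<in> M \<Longrightarrow> cinner m y = 0) \<Longrightarrow> orth_proj M y = 0"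
  by (rule orth_proj_eqI) (auto simp: csubspace_def)

lemma is_projectionI:
  assumes "bounded_op P" "\<And>x y. cinner (P x) y = cinner x (P y)" "\<And>x. P (P x) = P x"
  shows "is_projection P"
  using assms by (auto simp: is_projection_def selfadjoint_def)

lemma
  assumes "is_projection P"
  shows is_projection_bounded: "bounded_op P"
    and is_projection_clinear: "clinear P"
    and is_projection_sa: "cinner (P x) y = cinner x (P y)"
    and is_projection_idem: "P (P x) = P x"
  using assms by (auto simp: is_projection_def selfadjoint_def bounded_op_def fun_eq_iff)

lemma is_projection_orth_proj:
  assumes "csubspace M" "cclosed M"
  shows "is_projection (orth_proj M)"
proof (rule is_projectionI)
  note io = orth_proj_in[OF assms] orth_proj_orth[OF assms]
  have lin: "clinear (orth_proj M)"
    unfolding clinear_def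
  proof (intro conjI allI)
    show "orth_proj M (x + y) = orth_proj M x + orth_proj M y" for x y
    proof (rule orth_proj_eqI[OF assms(1)])
      fix m assume "m \<in> M"
      then show "cinner m (x + y - (orth_proj M x + orth_proj M y)) = 0"
        using io(2)[of m x] io(2)[of m y] by (simp add: cinner_simps)
    qed (use assms(1) in \<open>simp add: csubspace_def io(1)\<close>)
    show "orth_proj M (a *\<^sub>C x) = a *\<^sub>C orth_proj M x" for a x
    proof (rule orth_proj_eqI[OF assms(1)])
      fix m assume "m \<in> M"
      then show "cinner m (a *\<^sub>C x - a *\<^sub>C orth_proj M x) = 0"
        using io(2)[of m x] by (simp add: cinner_simps)
    qed (use assms(1) in \<open>simp add: csubspace_def io(1)\<close>)
  qed
  have "cnorm (orth_proj M x) \<le> 1 * cnorm x" for x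
  proof -
    let ?p = "orth_proj M x"
    have "(cnorm (?p + (x - ?p)))\<^sup>2 = (cnorm ?p)\<^sup>2 + (cnorm (x - ?p))\<^sup>2"
      using io(2)[OF io(1), of x x] by (subst cnorm_add_sq) simp
    then have "(cnorm ?p)\<^sup>2 \<le> (cnorm x)\<^sup>2" by simp
    then show ?thesis by (auto dest: power2_le_imp_le)
  qed
  with lin show "bounded_op (orth_proj M)" by (rule bounded_opI)
  show "orth_proj M (orth_proj M x) = orth_proj M x" for x
    using assms(1) io(1) by (rule orth_proj_ident)
  \<comment> \<open>Both sides equal the inner product of the two projected vectors.\<close>
  show "cinner (orth_proj M x) y = cinner x (orth_proj M y)" for x y
  proof -
    have "cinner (x - orth_proj M x) (orth_proj M y) = 0"
      using io(2)[OF io(1), of y x] cinner_conj[of "x - orth_proj M x" "orth_proj M y"] by simp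
    moreover have "cinner (orth_proj M x) (y - orth_proj M y) = 0"
      by (rule io(2)[OF io(1)])
    ultimately show ?thesis by (simp add: cinner_simps)
  qed
qed

lemma csubspace_kernel: "clinear f \<Longrightarrow> csubspace (kernel f)"
  by (auto simp: csubspace_def kernel_def clinear_simps)

lemma cclosed_kernel:
  assumes "bounded_op f"
  shows "cclosed (kernel f)"
  unfolding cclosed_def kernel_def
proof (intro allI impI)
  fix X L assume "\<forall>n. X n \<in> {x. f x = 0}" "ctendsto X L"
  then have "ctendsto (\<lambda>n. 0) (f L)" using ctendsto_bounded_op[OF assms, of X L] by simp
  from ctendsto_unique[OF this ctendsto_const] show "L \<in> {x. f x = 0}" by simp
qed

subsection \<open>Positive operators\<close>

text \<open>Extension by continuity: a map given only on a dense range and bounded there sends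
  convergent sequences to convergent ones.\<close>

lemma ctendsto_dominated:
  assumes "ctendsto X L" "\<And>m n. cnorm (Y m - Y n) \<le> K * cnorm (X m - X n)" "K > 0"
  obtains M where "ctendsto Y M"
proof (rule ctendsto_complete[of Y])
  fix e :: real assume "e > 0"
  then have "e / (2 * K) > 0" using assms(3) by simp
  with assms(1) obtain N where N: "\<And>n. n \<ge> N \<Longrightarrow> cnorm (X n - L) < e / (2 * K)"
    unfolding ctendsto_def LIMSEQ_iff by auto
  have "cnorm (Y m - Y n) < e" if "m \<ge> N" "n \<ge> N" for m n
  proof -
    have "cnorm (X m - X n) < e / (2 * K) + e / (2 * K)"
      using N[OF that(1)] N[OF that(2)] cnorm_triangle_diff[of "X m" "X n" L]
        cnorm_minus_commute[of L "X n"] by linarith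
    also have "\<dots> = e / K" by simp
    finally have "K * cnorm (X m - X n) < e" using assms(3) by (simp add: field_simps)
    then show ?thesis using assms(2)[of m n] by linarith
  qed
  then show "\<exists>N. \<forall>m\<ge>N. \<forall>n\<ge>N. cnorm (Y m - Y n) < e" by blast
qed (use that in blast)

text \<open>Polarization: reality of the form at \<open>x + y\<close> compares the imaginary parts,
  and at \<open>x + \<i> *\<^sub>C y\<close> the real parts.\<close>

lemma selfadjoint_if_real_form:
  assumes A: "clinear (A :: 'a::chilbert_space \<Rightarrow> 'a)" and real: "\<And>x. Im (cinner x (A x)) = 0"
  shows "cinner (A x) y = cinner x (A y)"
proof -
  have "Im (cinner x (A y)) + Im (cinner y (A x)) = 0"
    using real[of "x + y"] real[of x] real[of y] by (simp add: clinear_simps[OF A] cinner_simps)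
  moreover have "Re (cinner x (A y)) = Re (cinner y (A x))"
    using real[of "x + \<i> *\<^sub>C y"] real[of x] real[of y] by (simp add: clinear_simps[OF A] cinner_simps)
  ultimately show ?thesis
    using cinner_conj[of "A x" y] by (simp add: complex_eq_iff)
qed

lemma isometry_cinner:
  assumes f: "clinear f" and iso: "\<And>x. cnorm (f x) = cnorm x"
  shows "cinner (f x) (f y) = cinner x y"
proof -
  have *: "Re (cinner (f x) (f y)) = Re (cinner x y)" for x
    using iso[of "x + y"] cnorm_add_sq[of x y] cnorm_add_sq[of "f x" "f y"]
    by (simp add: clinear_simps[OF f] iso)
  from *[of x] *[of "\<i> *\<^sub>C x"] show ?thesis
    by (simp add: complex_eq_iff clinear_simps[OF f] cinner_simps)
qed

lemma positive_op_bounded: "positive_op A \<Longrightarrow> bounded_op A"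
  by (simp add: positive_op_def)

lemma positive_op_clinear: "positive_op A \<Longrightarrow> clinear A"
  by (simp add: positive_op_def bounded_op_def)

lemma positive_op_nonneg: "positive_op A \<Longrightarrow> 0 \<le> Re (cinner x (A x))"
  by (simp add: positive_op_def)

lemma positive_op_sa: "positive_op A \<Longrightarrow> cinner (A x) y = cinner x (A y)"
  by (rule selfadjoint_if_real_form) (auto simp: positive_op_def bounded_op_def)

lemma positive_opI:
  assumes "bounded_op A" "\<And>x y. cinner (A x) y = cinner x (A y)" "\<And>x. 0 \<le> Re (cinner x (A x))"
  shows "positive_op A"
proof -
  have "Im (cinner x (A x)) = 0" for x
    using assms(2)[of x x] arg_cong[OF cinner_conj[of "A x" x], of Im] by simp
  then show ?thesis using assms by (simp add: positive_op_def)
qed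

lemma positive_op_add:
  "positive_op A \<Longrightarrow> positive_op C \<Longrightarrow> positive_op (\<lambda>x. A x + C x)"
  unfolding positive_op_def by (intro conjI bounded_op_add) (simp_all add: cinner_simps)

lemma positive_op_scale:
  "positive_op A \<Longrightarrow> 0 \<le> r \<Longrightarrow> positive_op (\<lambda>x. complex_of_real r *\<^sub>C A x)"
  unfolding positive_op_def by (intro conjI bounded_op_scaleC) (simp_all add: cinner_simps)

lemma positive_op_id: "positive_op (\<lambda>x. x)"
  by (auto simp: positive_op_def cinner_nonneg)

lemma positive_op_square:
  assumes "positive_op A"
  shows "positive_op (\<lambda>x. A (A x))"
proof (rule positive_opI)
  show "bounded_op (\<lambda>x. A (A x))"
    by (rule bounded_op_compose[OF positive_op_bounded[OF assms] positive_op_bounded[OF assms]])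
  show "0 \<le> Re (cinner x (A (A x)))" for x
    using cinner_nonneg[of "A x"] positive_op_sa[OF assms, of x "A x"] by simp
qed (simp add: positive_op_sa[OF assms])

text \<open>This is \<open>A^2 <= K A\<close>. It comes from positivity of the form at
  \<open>x - t A x\<close>; the value \<open>t = 1 / K\<close> minimizes the upper bound that
  \<open><A x, A (A x)> <= K |A x|^2\<close> gives for it. No square root is involved, so the
  inequality can serve in their construction.\<close>

lemma positive_op_norm_sq:
  assumes A: "positive_op A" and K: "K > 0" "\<And>x. cnorm (A x) \<le> K * cnorm x"
  shows "(cnorm (A x))\<^sup>2 \<le> K * Re (cinner x (A x))"
proof -
  note A_simps = clinear_simps[OF positive_op_clinear[OF A]] cinner_simps
  have "cmod (cinner (A x) (A (A x))) \<le> cnorm (A x) * (K * cnorm (A x))"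
    using cinner_cauchy_schwarz[of "A x" "A (A x)"] mult_left_mono[OF K(2)[of "A x"], of "cnorm (A x)"]
    by simp
  then have 1: "Re (cinner (A x) (A (A x))) \<le> K * (cnorm (A x))\<^sup>2"
    using complex_Re_le_cmod[of "cinner (A x) (A (A x))"] by (simp add: power2_eq_square ac_simps)
  define t where "t = complex_of_real (1 / K)"
  have "0 \<le> Re (cinner (x - t *\<^sub>C A x) (A (x - t *\<^sub>C A x)))"
    using A by (rule positive_op_nonneg)
  also have "cinner (x - t *\<^sub>C A x) (A (x - t *\<^sub>C A x))
      = cinner x (A x) - 2 * t * cinner (A x) (A x) + t * t * cinner (A x) (A (A x))"
    using positive_op_sa[OF A, of x "A x"] by (simp add: A_simps t_def algebra_simps)
  finally have "0 \<le> Re (cinner x (A x)) - 2 / K * (cnorm (A x))\<^sup>2 + Re (cinner (A x) (A (A x))) / K\<^sup>2"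
    by (simp add: t_def cinner_self power2_eq_square)
  also have "\<dots> \<le> Re (cinner x (A x)) - 2 / K * (cnorm (A x))\<^sup>2 + K * (cnorm (A x))\<^sup>2 / K\<^sup>2"
    using 1 by (intro add_left_mono divide_right_mono) auto
  also have "\<dots> = Re (cinner x (A x)) - (cnorm (A x))\<^sup>2 / K"
    using K(1) by (simp add: power2_eq_square)
  finally show ?thesis using K(1) by (simp add: field_simps)
qed

lemma positive_op_eq_0:
  assumes "positive_op A" "Re (cinner x (A x)) = 0"
  shows "A x = 0"
proof -
  obtain K where "K > 0" "\<And>x. cnorm (A x) \<le> K * cnorm x"
    using bounded_op_bound positive_op_bounded assms by metis
  from positive_op_norm_sq[OF assms(1) this, of x] assms(2) show ?thesis by simp
qed

subsection \<open>Square roots of positive operators\<close>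

text \<open>The iteration converges to \<open>1 - sqrt (1 - X)\<close>; for a contraction \<open>X\<close> it is
  majorized by the same iteration for the scalar \<open>1\<close>.\<close>

fun sqrt_iter :: "('a::chilbert_space \<Rightarrow> 'a) \<Rightarrow> nat \<Rightarrow> 'a \<Rightarrow> 'a" where
  "sqrt_iter X 0 x = 0"
| "sqrt_iter X (Suc n) x = (1/2) *\<^sub>C (X x + sqrt_iter X n (sqrt_iter X n x))"

fun sqrt_major :: "nat \<Rightarrow> real" where
  "sqrt_major 0 = 0"
| "sqrt_major (Suc n) = (1 + (sqrt_major n)\<^sup>2) / 2"

lemma sqrt_major_bounds: "0 \<le> sqrt_major n \<and> sqrt_major n \<le> 1"
  by (induction n) (auto simp: power_le_one)

lemma sqrt_major_Suc: "sqrt_major n \<le> sqrt_major (Suc n)"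
  using zero_le_power2[of "1 - sqrt_major n"] by (simp add: power2_eq_square algebra_simps)

lemma sqrt_major_cauchy: "Cauchy sqrt_major"
proof -
  have "incseq sqrt_major" using sqrt_major_Suc by (rule incseq_SucI)
  then have "convergent sqrt_major"
    using sqrt_major_bounds by (intro Bseq_mono_convergent BseqI'[of _ 1]) (auto simp: incseq_def)
  then show ?thesis by (simp add: Cauchy_convergent_iff)
qed

context
  fixes X :: "'a::chilbert_space \<Rightarrow> 'a"
  assumes X: "bounded_op X"
    and X_sa: "\<And>x y. cinner (X x) y = cinner x (X y)"
    and X_contr: "\<And>x. cnorm (X x) \<le> cnorm x"
begin

lemma sqrt_iter_bounded: "bounded_op (sqrt_iter X n)"
  by (induction n) (auto intro!: bounded_op_scaleC bounded_op_add X bounded_op_compose[of "sqrt_iter X _" "sqrt_iter X _"])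

lemmas sqrt_iter_simps = clinear_simps[OF bounded_op_clinear[OF sqrt_iter_bounded]]

text \<open>Every iterate is a polynomial in \<open>X\<close>. In the limit this gives the
  commutation property of the square root, and here it lets different iterates commute with each
  other.\<close>

lemma sqrt_iter_commute:
  assumes Z: "clinear Z" and ZX: "\<And>x. Z (X x) = X (Z x)"
  shows "Z (sqrt_iter X n x) = sqrt_iter X n (Z x)"
  by (induction n arbitrary: x) (auto simp: clinear_simps[OF Z] ZX)

lemma sqrt_iter_sa: "cinner (sqrt_iter X n x) y = cinner x (sqrt_iter X n y)"
  by (induction n arbitrary: x y) (auto simp: cinner_simps X_sa)

lemma sqrt_iter_norm: "cnorm (sqrt_iter X n x) \<le> sqrt_major n * cnorm x"
proof (induction n arbitrary: x)
  case (Suc n)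
  have "cnorm (sqrt_iter X n (sqrt_iter X n x)) \<le> sqrt_major n * (sqrt_major n * cnorm x)"
    using Suc[of "sqrt_iter X n x"] mult_left_mono[OF Suc[of x], of "sqrt_major n"] sqrt_major_bounds[of n]
    by linarith
  then have "cnorm (X x + sqrt_iter X n (sqrt_iter X n x)) \<le> (1 + (sqrt_major n)\<^sup>2) * cnorm x"
    using cnorm_triangle[of "X x" "sqrt_iter X n (sqrt_iter X n x)"] X_contr[of x]
    by (simp add: algebra_simps power2_eq_square)
  then show ?case by (simp add: cnorm_scaleC)
qed simp

text \<open>Since consecutive iterates commute, the difference of their squares factors as sum times
  difference, exactly as for the scalar majorant; the bounds for both factors then multiply to the
  next scalar increment.\<close>

lemma sqrt_iter_step:
  "cnorm (sqrt_iter X (Suc n) x - sqrt_iter X n x) \<le> (sqrt_major (Suc n) - sqrt_major n) * cnorm x"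
proof (induction n arbitrary: x)
  case 0
  then show ?case using X_contr[of x] by (simp add: cnorm_scaleC)
next
  case (Suc n)
  let ?Y = "sqrt_iter X" and ?t = sqrt_major
  define d where "d = ?Y (Suc n) x - ?Y n x"
  have comm: "?Y (Suc n) (?Y n x) = ?Y n (?Y (Suc n) x)"
    by (rule sqrt_iter_commute[symmetric])
      (auto simp: bounded_op_clinear sqrt_iter_bounded sqrt_iter_commute[symmetric] X)
  have "?Y (Suc (Suc n)) x - ?Y (Suc n) x = (1/2) *\<^sub>C (?Y (Suc n) (?Y (Suc n) x) - ?Y n (?Y n x))"
    by (simp only: sqrt_iter.simps(2)[of X "Suc n"] sqrt_iter.simps(2)[of X n x])
      (simp add: cv.scale_right_diff_distrib cv.scale_right_distrib)
  also have "?Y (Suc n) (?Y (Suc n) x) - ?Y n (?Y n x) = ?Y (Suc n) d + ?Y n d"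
    unfolding d_def by (simp only: sqrt_iter_simps comm) simp
  finally have 1: "cnorm (?Y (Suc (Suc n)) x - ?Y (Suc n) x) = (1/2) * cnorm (?Y (Suc n) d + ?Y n d)"
    by (simp only: cnorm_scaleC) simp
  have "cnorm (?Y (Suc n) d + ?Y n d) \<le> ?t (Suc n) * cnorm d + ?t n * cnorm d"
    using cnorm_triangle sqrt_iter_norm add_mono by (meson order_trans)
  also have "\<dots> = (?t (Suc n) + ?t n) * cnorm d" by (simp add: algebra_simps)
  also have "\<dots> \<le> (?t (Suc n) + ?t n) * ((?t (Suc n) - ?t n) * cnorm x)"
    using Suc sqrt_major_bounds[of n] sqrt_major_bounds[of "Suc n"] unfolding d_def
    by (intro mult_left_mono) auto
  also have "(?t (Suc n) + ?t n) * ((?t (Suc n) - ?t n) * cnorm x)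
      = 2 * ((?t (Suc (Suc n)) - ?t (Suc n)) * cnorm x)"
    by (simp only: sqrt_major.simps(2)[of "Suc n"] sqrt_major.simps(2)[of n])
      (simp add: field_simps power2_eq_square)
  finally show ?case using 1 by linarith
qed

lemma sqrt_iter_diff:
  assumes "n \<le> m"
  shows "cnorm (sqrt_iter X m x - sqrt_iter X n x) \<le> (sqrt_major m - sqrt_major n) * cnorm x"
  using assms
proof (induction m rule: dec_induct)
  case (step m)
  have "cnorm (sqrt_iter X (Suc m) x - sqrt_iter X n x) \<le>
      cnorm (sqrt_iter X (Suc m) x - sqrt_iter X m x) + cnorm (sqrt_iter X m x - sqrt_iter X n x)"
    by (rule cnorm_triangle_diff)
  also have "\<dots> \<le> (sqrt_major (Suc m) - sqrt_major m) * cnorm x + (sqrt_major m - sqrt_major n) * cnorm x"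
    by (intro add_mono sqrt_iter_step step)
  finally show ?case by (simp only: left_diff_distrib)
qed simp

lemma sqrt_iter_converges: "\<exists>L. ctendsto (\<lambda>n. sqrt_iter X n x) L"
proof (rule ctendsto_complete[of "\<lambda>n. sqrt_iter X n x"])
  fix e :: real assume e: "e > 0"
  \<comment> \<open>The added 1 avoids division by zero for \<open>x = 0\<close>.\<close>
  define c where "c = cnorm x + 1"
  have c: "c > 0" "cnorm x \<le> c" using cnorm_ge_0[of x] unfolding c_def by linarith+
  obtain N where N: "\<And>m n. m \<ge> N \<Longrightarrow> n \<ge> N \<Longrightarrow> \<bar>sqrt_major m - sqrt_major n\<bar> < e / c"
    using metric_CauchyD[OF sqrt_major_cauchy, of "e / c"] e c by (auto simp: dist_real_def)
  have *: "cnorm (sqrt_iter X m x - sqrt_iter X n x) < e" if "m \<ge> n" "n \<ge> N" for m n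
  proof -
    have "\<bar>sqrt_major m - sqrt_major n\<bar> * cnorm x \<le> \<bar>sqrt_major m - sqrt_major n\<bar> * c"
      using c by (intro mult_left_mono) auto
    also have "\<dots> < e" using N[of m n] that c by (simp add: field_simps)
    finally have "\<bar>sqrt_major m - sqrt_major n\<bar> * cnorm x < e" .
    moreover have "(sqrt_major m - sqrt_major n) * cnorm x \<le> \<bar>sqrt_major m - sqrt_major n\<bar> * cnorm x"
      by (intro mult_right_mono) auto
    ultimately show ?thesis using sqrt_iter_diff[OF that(1), of x] by linarith
  qed
  have "cnorm (sqrt_iter X m x - sqrt_iter X n x) < e" if "m \<ge> N" "n \<ge> N" for m n
    using *[of n m] *[of m n] that cnorm_minus_commute[of "sqrt_iter X m x"] by (cases "m \<ge> n") auto
  then show "\<exists>N. \<forall>m\<ge>N. \<forall>n\<ge>N. cnorm (sqrt_iter X m x - sqrt_iter X n x) < e" by blast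
qed blast

text \<open>The pointwise limit \<open>Y\<close> satisfies \<open>Y = (X + Y^2) / 2\<close>, that is
  \<open>(1 - Y)^2 = 1 - X\<close>, and is a contraction, so \<open>1 - Y\<close> is the positive
  root.\<close>

lemma sqrt_of_contraction:
  "\<exists>S. positive_op S \<and> (\<forall>x. S (S x) = x - X x)
     \<and> (\<forall>Z. bounded_op Z \<longrightarrow> (\<forall>x. Z (X x) = X (Z x)) \<longrightarrow> (\<forall>x. Z (S x) = S (Z x)))"
proof -
  obtain Y where Y: "\<And>x. ctendsto (\<lambda>n. sqrt_iter X n x) (Y x)"
    using sqrt_iter_converges by metis
  have Y_contr: "cnorm (Y x) \<le> 1 * cnorm x" for x
  proof (rule LIMSEQ_le_const2[OF ctendsto_cnorm[OF Y]])
    have "sqrt_major n * cnorm x \<le> 1 * cnorm x" for n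
      using sqrt_major_bounds[of n] by (intro mult_right_mono) auto
    then show "\<exists>N. \<forall>n\<ge>N. cnorm (sqrt_iter X n x) \<le> 1 * cnorm x"
      using sqrt_iter_norm[of _ x] order_trans by blast
  qed
  have "clinear Y"
    unfolding clinear_def
  proof (intro conjI allI)
    show "Y (x + y) = Y x + Y y" for x y
      using ctendsto_add[OF Y[of x] Y[of y]] Y[of "x + y"] by (auto simp: sqrt_iter_simps dest: ctendsto_unique)
    show "Y (a *\<^sub>C x) = a *\<^sub>C Y x" for a x
      using ctendsto_bounded_op[OF bounded_op_scaleC[OF bounded_op_id] Y, of a x] Y[of "a *\<^sub>C x"]
      by (auto simp: sqrt_iter_simps dest: ctendsto_unique)
  qed
  then have Y_bdd: "bounded_op Y" using Y_contr by (rule bounded_opI)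
  note Y_simps = clinear_simps[OF \<open>clinear Y\<close>]
  have Y_sa: "cinner (Y x) y = cinner x (Y y)" for x y
  proof -
    have "(\<lambda>n. cnj (cinner y (sqrt_iter X n x))) \<longlonglongrightarrow> cnj (cinner y (Y x))"
      by (intro tendsto_cnj ctendsto_cinner Y)
    moreover have "cnj (cinner y (sqrt_iter X n x)) = cinner x (sqrt_iter X n y)" for n
      using cinner_conj[of "sqrt_iter X n x" y] sqrt_iter_sa[of n x y] by simp
    ultimately show ?thesis
      using LIMSEQ_unique[OF _ ctendsto_cinner[OF Y[of y], of x]] cinner_conj[of "Y x" y] by simp
  qed
  have Y_comm: "Z (Y x) = Y (Z x)" if "bounded_op Z" "\<And>x. Z (X x) = X (Z x)" for Z x
    using ctendsto_bounded_op[OF that(1) Y[of x]] Y[of "Z x"]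
    by (simp add: sqrt_iter_commute[OF bounded_op_clinear[OF that(1)] that(2)] ctendsto_unique)
  \<comment> \<open>Pointwise convergence alone does not pass to squares; the uniform bound 1 on the
    norms of the iterates is what makes it work.\<close>
  have YY: "ctendsto (\<lambda>n. sqrt_iter X n (sqrt_iter X n x)) (Y (Y x))" for x
  proof (rule ctendstoI)
    show "cnorm (sqrt_iter X n (sqrt_iter X n x) - Y (Y x))
        \<le> cnorm (sqrt_iter X n x - Y x) + cnorm (sqrt_iter X n (Y x) - Y (Y x))" for n
    proof -
      have "cnorm (sqrt_iter X n (sqrt_iter X n x) - sqrt_iter X n (Y x)) \<le> sqrt_major n * cnorm (sqrt_iter X n x - Y x)"
        using sqrt_iter_norm[of n "sqrt_iter X n x - Y x"] by (simp add: sqrt_iter_simps)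
      also have "\<dots> \<le> 1 * cnorm (sqrt_iter X n x - Y x)"
        using sqrt_major_bounds[of n] by (intro mult_right_mono) auto
      finally show ?thesis
        using cnorm_triangle_diff[of "sqrt_iter X n (sqrt_iter X n x)" "Y (Y x)" "sqrt_iter X n (Y x)"]
        by simp
    qed
    show "(\<lambda>n. cnorm (sqrt_iter X n x - Y x) + cnorm (sqrt_iter X n (Y x) - Y (Y x))) \<longlonglongrightarrow> 0"
      using tendsto_add[OF Y[of x, unfolded ctendsto_def] Y[of "Y x", unfolded ctendsto_def]] by simp
  qed
  have "Y x = (1/2) *\<^sub>C (X x + Y (Y x))" for x
  proof -
    have "ctendsto (\<lambda>n. (1/2) *\<^sub>C (X x + sqrt_iter X n (sqrt_iter X n x))) ((1/2) *\<^sub>C (X x + Y (Y x)))"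
      by (intro ctendsto_bounded_op[OF bounded_op_scaleC[OF bounded_op_id]] ctendsto_add ctendsto_const YY)
    moreover have "ctendsto (\<lambda>n. sqrt_iter X (Suc n) x) (Y x)"
      using Y[of x] unfolding ctendsto_def by (rule LIMSEQ_Suc)
    ultimately show ?thesis using ctendsto_unique by auto
  qed
  then have "cinner z (Y x) = cinner z ((1/2) *\<^sub>C (X x + Y (Y x)))" for x z
    by (rule arg_cong)
  then have Y_eq: "cinner z (Y (Y x)) = 2 * cinner z (Y x) - cinner z (X x)" for x z
    by (simp add: cinner_simps field_simps)
  define S where "S x = x - Y x" for x
  have "positive_op S"
  proof (rule positive_opI)
    show "bounded_op S" unfolding S_def by (intro bounded_op_intros Y_bdd)
    show "cinner (S x) y = cinner x (S y)" for x y by (simp add: S_def cinner_simps Y_sa)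
    show "0 \<le> Re (cinner x (S x))" for x
    proof -
      have "Re (cinner x (Y x)) \<le> cnorm x * cnorm (Y x)"
        using cinner_cauchy_schwarz[of x "Y x"] complex_Re_le_cmod[of "cinner x (Y x)"] by linarith
      also have "\<dots> \<le> cnorm x * cnorm x" using Y_contr[of x] by (intro mult_left_mono) auto
      finally show ?thesis by (simp add: S_def cinner_simps cnorm_sq[symmetric] power2_eq_square[symmetric])
    qed
  qed
  moreover have "S (S x) = x - X x" for x
    by (rule cinner_ext) (simp add: S_def Y_simps cinner_simps Y_eq)
  moreover have "Z (S x) = S (Z x)" if "bounded_op Z" "\<And>x. Z (X x) = X (Z x)" for Z x
    using Y_comm[OF that] by (simp add: S_def clinear_simps[OF bounded_op_clinear[OF that(1)]])
  ultimately show ?thesis by blast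
qed

end

text \<open>After rescaling by a bound \<open>K\<close>, the operator \<open>1 - A / K\<close> is a
  contraction, because \<open>A^2 <= K A\<close> makes the quadratic term at most half of the linear
  one. The root of \<open>A / K\<close> is then multiplied by \<open>sqrt K\<close>.\<close>

lemma positive_sqrt_exists:
  assumes A: "positive_op (A :: 'a::chilbert_space \<Rightarrow> 'a)"
  shows "\<exists>S. positive_op S \<and> (\<forall>x. S (S x) = A x)
     \<and> (\<forall>Z. bounded_op Z \<longrightarrow> (\<forall>x. Z (A x) = A (Z x)) \<longrightarrow> (\<forall>x. Z (S x) = S (Z x)))"
proof -
  obtain K where K: "K > 0" "\<And>x. cnorm (A x) \<le> K * cnorm x"
    using bounded_op_bound positive_op_bounded A by metis
  define X where "X x = x - complex_of_real (1 / K) *\<^sub>C A x" for x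
  have bdd: "bounded_op X"
    unfolding X_def by (intro bounded_op_intros positive_op_bounded A)
  have sa: "cinner (X x) y = cinner x (X y)" for x y
    by (simp add: X_def cinner_simps positive_op_sa[OF A])
  have "cnorm (X x) \<le> cnorm x" for x
  proof (rule power2_le_imp_le)
    have "cinner (X x) (X x) = cinner x x - complex_of_real (2 / K) * cinner x (A x)
        + complex_of_real (1 / K\<^sup>2) * cinner (A x) (A x)"
      by (simp add: X_def cinner_simps positive_op_sa[OF A] algebra_simps power2_eq_square)
    then have "(cnorm (X x))\<^sup>2 = (cnorm x)\<^sup>2 - 2 / K * Re (cinner x (A x)) + (cnorm (A x))\<^sup>2 / K\<^sup>2"
      by (simp add: cnorm_sq flip: of_real_divide of_real_power)
    moreover have "(cnorm (A x))\<^sup>2 / K\<^sup>2 \<le> K * Re (cinner x (A x)) / K\<^sup>2"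
      by (intro divide_right_mono positive_op_norm_sq A K) simp
    moreover have "K * Re (cinner x (A x)) / K\<^sup>2 = 1 / K * Re (cinner x (A x))"
      using K(1) by (simp add: power2_eq_square)
    moreover have "1 / K * Re (cinner x (A x)) \<ge> 0"
      using K(1) positive_op_nonneg[OF A] by simp
    ultimately show "(cnorm (X x))\<^sup>2 \<le> (cnorm x)\<^sup>2" by simp
  qed simp
  from sqrt_of_contraction[OF bdd sa this] obtain S where S: "positive_op S" "\<And>x. S (S x) = x - X x"
    "\<And>Z x. bounded_op Z \<Longrightarrow> (\<And>x. Z (X x) = X (Z x)) \<Longrightarrow> Z (S x) = S (Z x)"
    by blast
  define R where "R x = complex_of_real (sqrt K) *\<^sub>C S x" for x
  have "positive_op R" unfolding R_def using S(1) K(1) by (intro positive_op_scale) auto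
  moreover have "R (R x) = A x" for x
    using K(1) by (simp add: R_def clinear_simps[OF positive_op_clinear[OF S(1)]] S(2) X_def
        scaleC_scaleC flip: of_real_mult)
  moreover have "Z (R x) = R (Z x)" if "bounded_op Z" "\<And>x. Z (A x) = A (Z x)" for Z x
    using S(3)[OF that(1), of x] that(2)
    by (simp add: R_def X_def clinear_simps[OF bounded_op_clinear[OF that(1)]])
  ultimately show ?thesis by blast
qed

text \<open>For \<open>y = R x - S x\<close> commutation gives
  \<open>(R + S) y = R^2 x - S^2 x = 0\<close>; positivity separates this into
  \<open>R y = 0\<close> and \<open>S y = 0\<close>, and \<open><y, y> = <x, (R - S) y>\<close>
  vanishes.\<close>

lemma positive_sqrt_unique:
  assumes "positive_op R" "positive_op S" "\<And>x. R (R x) = S (S x)" "\<And>x. R (S x) = S (R x)"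
  shows "R = S"
proof
  fix x
  note lin = clinear_simps[OF positive_op_clinear[OF assms(1)]] clinear_simps[OF positive_op_clinear[OF assms(2)]]
  define y where "y = R x - S x"
  have "R y + S y = 0" by (simp add: y_def lin assms(3,4))
  then have "cinner y (R y) + cinner y (S y) = 0" by (simp flip: cinner_add_right)
  then have "Re (cinner y (R y)) + Re (cinner y (S y)) = 0" by (metis plus_complex.sel(1) zero_complex.sel(1))
  with positive_op_nonneg[OF assms(1), of y] positive_op_nonneg[OF assms(2), of y]
  have "R y = 0" "S y = 0" using positive_op_eq_0 assms(1,2) by (metis add_nonneg_eq_0_iff)+
  then have "cinner x (R y - S y) = 0" by simp
  moreover have "cinner y y = cinner x (R y - S y)"
    by (simp add: y_def cinner_simps positive_op_sa[OF assms(1)] positive_op_sa[OF assms(2)] lin)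
  ultimately have "y = 0" by (simp add: cinner_eq_zero)
  then show "R x = S x" by (simp add: y_def)
qed

text \<open>Uniqueness for the definite description: any positive root commutes with its own square
  \<open>A\<close>, hence with the constructed root, so the commuting case of uniqueness covers all
  roots.\<close>

lemma
  assumes A: "positive_op A"
  shows op_sqrt_positive: "positive_op (op_sqrt A)"
    and op_sqrt_square: "op_sqrt A (op_sqrt A x) = A x"
    and op_sqrt_commute: "bounded_op Z \<Longrightarrow> (\<And>x. Z (A x) = A (Z x)) \<Longrightarrow> Z (op_sqrt A x) = op_sqrt A (Z x)"
proof -
  obtain S where S: "positive_op S" "\<And>x. S (S x) = A x"
    "\<And>Z x. bounded_op Z \<Longrightarrow> (\<And>x. Z (A x) = A (Z x)) \<Longrightarrow> Z (S x) = S (Z x)"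
    using positive_sqrt_exists[OF A] by blast
  have "op_sqrt A = S"
    unfolding op_sqrt_def
  proof (rule the_equality)
    show "positive_op S \<and> S \<circ> S = A" using S by auto
    fix R assume R: "positive_op R \<and> R \<circ> R = A"
    then have RR: "R (R x) = A x" for x by auto
    then have "R (S x) = S (R x)" for x
      using R by (intro S(3)) (auto simp: positive_op_bounded simp flip: RR)
    then show "R = S" using R RR S(1,2) by (intro positive_sqrt_unique) auto
  qed
  then show "positive_op (op_sqrt A)" "op_sqrt A (op_sqrt A x) = A x"
    "bounded_op Z \<Longrightarrow> (\<And>x. Z (A x) = A (Z x)) \<Longrightarrow> Z (op_sqrt A x) = op_sqrt A (Z x)"
    using S by auto
qed

text \<open>\<open>B\<close> is itself the positive root of its square, and that root commutes with
  whatever commutes with the square.\<close>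

lemma commute_if_commute_square:
  assumes "positive_op B" "bounded_op Z" "\<And>x. Z (B (B x)) = B (B (Z x))"
  shows "Z (B x) = B (Z x)"
proof -
  let ?A = "\<lambda>x. B (B x)"
  have A: "positive_op ?A" using assms(1) by (rule positive_op_square)
  have "op_sqrt ?A = B"
  proof (rule positive_sqrt_unique)
    show "op_sqrt ?A (B x) = B (op_sqrt ?A x)" for x
      using op_sqrt_commute[OF A positive_op_bounded[OF assms(1)], of x] by simp
  qed (use assms(1) A in \<open>simp_all add: op_sqrt_positive op_sqrt_square[OF A]\<close>)
  then show ?thesis using op_sqrt_commute[OF A assms(2), of x] assms(3) by simp
qed

text \<open>The product equals \<open>A^(1/2) C A^(1/2)\<close>, whose form is the form of
  \<open>C\<close> at \<open>A^(1/2) x\<close>.\<close>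

lemma positive_op_commuting_product:
  assumes A: "positive_op A" and C: "positive_op C" and comm: "\<And>x. A (C x) = C (A x)"
  shows "positive_op (\<lambda>x. A (C x))"
proof (rule positive_opI)
  show "bounded_op (\<lambda>x. A (C x))" by (rule bounded_op_compose[OF positive_op_bounded[OF A] positive_op_bounded[OF C]])
  show "cinner (A (C x)) y = cinner x (A (C y))" for x y
    by (simp add: positive_op_sa[OF A] positive_op_sa[OF C] comm)
  fix x
  let ?S = "op_sqrt A"
  have "A (C x) = ?S (C (?S x))"
    using op_sqrt_commute[OF A positive_op_bounded[OF C], of x] comm by (simp add: op_sqrt_square[OF A])
  then have "cinner x (A (C x)) = cinner (?S x) (C (?S x))"
    by (simp add: positive_op_sa[OF op_sqrt_positive[OF A]])
  then show "0 \<le> Re (cinner x (A (C x)))" using positive_op_nonneg[OF C] by simp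
qed

text \<open>The lower bound makes \<open>A\<close> injective and its range closed; self-adjointness
  makes the complement of the range equal to the trivial kernel, so the range is everything.\<close>

lemma
  assumes A: "bounded_op A" and sa: "\<And>x y. cinner (A x) y = cinner x (A y)"
    and c: "c > 0" "\<And>x. c * cnorm x \<le> cnorm (A x)"
  shows op_inverse_bounded: "bounded_op (op_inverse A)"
    and op_inverse_left: "op_inverse A (A x) = x"
    and op_inverse_right: "A (op_inverse A x) = x"
proof -
  note lin = clinear_simps[OF bounded_op_clinear[OF A]]
  have bound: "cnorm x \<le> 1 / c * cnorm (A x)" for x
    using c(1) c(2)[of x] by (simp add: field_simps)
  have inj: "x = y" if "A x = A y" for x y
    using bound[of "x - y"] that cnorm_ge_0[of "x - y"] by (simp add: lin)
  have surj: "\<exists>x. A x = y" for y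
  proof -
    have sub: "csubspace (range A)"
      unfolding csubspace_def
    proof (intro conjI ballI allI)
      show "0 \<in> range A" by (metis lin(3) rangeI)
      show "u + v \<in> range A" if "u \<in> range A" "v \<in> range A" for u v
        using that by (auto simp flip: lin(1))
      show "a *\<^sub>C u \<in> range A" if "u \<in> range A" for a u
        using that by (auto simp flip: lin(2))
    qed
    have orth: "x = 0" if "\<And>m. m \<in> range A \<Longrightarrow> cinner m x = 0" for x
    proof -
      have "A x = 0" using that[of "A (A x)"] cinner_eq_zero[of "A x"] sa by simp
      then show ?thesis using inj lin(3) by metis
    qed
    have "\<exists>X. (\<forall>n. X n \<in> range A) \<and> ctendsto X y"
      by (rule dense_if_orthogonal_trivial[OF sub]) (rule orth)
    then obtain X where X: "\<forall>n. X n \<in> range A" "ctendsto X y" by blast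
    have "\<exists>z. X n = A z" for n using X(1) by blast
    then obtain Y where Y: "\<And>n. X n = A (Y n)" by metis
    obtain z where z: "ctendsto Y z"
    proof (rule ctendsto_dominated[OF X(2), of Y "1 / c"])
      show "cnorm (Y m - Y n) \<le> 1 / c * cnorm (X m - X n)" for m n
        using bound[of "Y m - Y n"] by (simp add: Y lin)
    qed (use c(1) in simp_all)
    have "ctendsto X (A z)" using ctendsto_bounded_op[OF A z] by (simp flip: Y)
    then have "A z = y" using X(2) by (rule ctendsto_unique)
    then show ?thesis by blast
  qed
  define R where "R = inv A"
  have "inj A" by (rule injI) (rule inj)
  then have RA: "R (A x) = x" for x by (simp add: R_def)
  have "surj A" unfolding surj_def by (metis surj)
  then have AR: "A (R x) = x" for x unfolding R_def by (rule surj_f_inv_f)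
  have R: "bounded_op R"
  proof (rule bounded_opI)
    show "clinear R"
      unfolding clinear_def by (intro conjI allI; rule inj) (simp_all add: lin AR)
    show "cnorm (R x) \<le> 1 / c * cnorm x" for x using bound[of "R x"] by (simp add: AR)
  qed
  have "op_inverse A = R"
    unfolding op_inverse_def
  proof (rule the_equality)
    show "bounded_op R \<and> R \<circ> A = id \<and> A \<circ> R = id" using R RA AR by auto
    show "S = R" if "bounded_op S \<and> S \<circ> A = id \<and> A \<circ> S = id" for S
    proof
      fix x
      have "S (A (R x)) = R x" using that by (metis comp_apply id_apply)
      then show "S x = R x" by (simp add: AR)
    qed
  qed
  then show "bounded_op (op_inverse A)" "op_inverse A (A x) = x" "A (op_inverse A x) = x"
    using R RA AR by auto
qed

subsection \<open>The operators on one copy of the generic part\<close>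

lemma adjoint_eqI:
  assumes "\<And>x y. cinner (A x) y = cinner x (S y)"
  shows "adjoint A = S"
  unfolding adjoint_def
proof (rule the_equality)
  fix R assume R: "\<forall>x y. cinner (A x) y = cinner x (R y)"
  show "R = S"
  proof
    show "R y = S y" for y by (rule cinner_ext) (metis R assms)
  qed
qed (use assms in blast)

text \<open>The definite description in \<open>adjoint\<close> is resolved by exhibiting the inverse
  of \<open>U\<close> as an adjoint.\<close>

lemma
  assumes U: "unitary U"
  shows unitary_adjoint: "cinner (U x) y = cinner x (adjoint U y)"
    and adjoint_unitary_left: "adjoint U (U x) = x"
    and adjoint_unitary_right: "U (adjoint U x) = x"
    and bounded_op_adjoint_unitary: "bounded_op (adjoint U)"
proof -
  have lin: "clinear U" and iso: "\<And>x y. cinner (U x) (U y) = cinner x y" and "surj U"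
    using U by (auto simp: unitary_def bounded_op_def)
  then have R: "U (inv U x) = x" for x by (simp add: surj_f_inv_f)
  have adj: "cinner (U x) y = cinner x (inv U y)" for x y
    using iso[of x "inv U y"] R by simp
  then have eq: "adjoint U = inv U" by (rule adjoint_eqI)
  have inj: "x = y" if "U x = U y" for x y
    by (rule cinner_ext) (metis iso that)
  show "cinner (U x) y = cinner x (adjoint U y)" "U (adjoint U x) = x"
    using adj R by (simp_all add: eq)
  show "adjoint U (U x) = x" using inj R unfolding eq by blast
  have norm: "cnorm (U x) = cnorm x" for x using iso[of x x] by (simp add: cnorm_def)
  show "bounded_op (adjoint U)"
    unfolding eq
  proof (rule bounded_opI)
    show "clinear (inv U)"
      unfolding clinear_def by (intro conjI allI; rule inj) (simp_all add: clinear_simps[OF lin] R)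
    show "cnorm (inv U x) \<le> 1 * cnorm x" for x using norm[of "inv U x"] R by simp
  qed
qed

lemma unitary_bounded: "unitary U \<Longrightarrow> bounded_op U"
  by (simp add: unitary_def)

text \<open>For \<open>lam \<noteq> 1\<close> the operator \<open>B\<close> of the theorem is bounded below and the inverse part is
  \<open>F = (lam\<^sup>2 - 1) / 4 B\<inverse>\<close>; for \<open>lam = 1\<close> the scalar factor vanishes and \<open>B\<close> need not be
  invertible. In both cases the upper left corners of \<open>2 lam P\<^sub>U\<close> and \<open>2 Q\<^sub>U\<close> are
  \<open>lam + B + F\<close> and \<open>1 + B - F\<close>.\<close>

definition inverse_part :: "real \<Rightarrow> ('b::chilbert_space \<Rightarrow> 'b) \<Rightarrow> 'b \<Rightarrow> 'b" where
  "inverse_part lam B x = (if lam = 1 then 0 else complex_of_real ((lam\<^sup>2 - 1) / 4) *\<^sub>C op_inverse B x)"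

text \<open>The operator under the root in \<open>P12\<close>. The general expression would be
  \<open>B^2 (1 - B^2)\<close> at \<open>lam = 1\<close>; there the factor \<open>B^2\<close> is
  left out, matching the absence of the outer inverse in \<open>P12\<close>.\<close>

definition radicand :: "real \<Rightarrow> ('b::chilbert_space \<Rightarrow> 'b) \<Rightarrow> 'b \<Rightarrow> 'b" where
  "radicand lam B x = (if lam = 1 then x - B (B x) else
     neg_op (shift (B \<circ> B) (((1 + lam) / 2)\<^sup>2) \<circ> shift (B \<circ> B) (((1 - lam) / 2)\<^sup>2)) x)"

lemma P12_eq:
  "P12 lam B x = (if lam = 1 then op_sqrt (radicand lam B) x else op_inverse B (op_sqrt (radicand lam B) x))"
  by (simp add: P12_def radicand_def[abs_def] eta_contract_eq)

locale generic_block =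
  fixes lam :: real and B :: "'b::chilbert_space \<Rightarrow> 'b"
  assumes lam_ne: "lam \<noteq> -1" "lam \<noteq> 0"
    and B_pos: "positive_op B"
    and B_lower: "op_less (scal_op (\<bar>1 - \<bar>lam\<bar>\<bar> / 2)) B"
    and B_upper: "op_less B (scal_op ((1 + \<bar>lam\<bar>) / 2))"
begin

definition "lo = \<bar>1 - \<bar>lam\<bar>\<bar> / 2"
definition "hi = (1 + \<bar>lam\<bar>) / 2"

abbreviation kap :: complex where "kap \<equiv> complex_of_real ((lam\<^sup>2 - 1) / 4)"

abbreviation F :: "'b \<Rightarrow> 'b" where "F \<equiv> inverse_part lam B"

abbreviation R :: "'b \<Rightarrow> 'b" where "R \<equiv> radicand lam B"

abbreviation N :: "'b \<Rightarrow> 'b" where "N \<equiv> P12 lam B"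

section \<open>Consequences of the bounds on \<open>B\<close>\<close>

lemma B_bounded: "bounded_op B" by (rule positive_op_bounded[OF B_pos])
lemmas B_lin = clinear_simps[OF bounded_op_clinear[OF B_bounded]]
lemma B_sa: "cinner (B x) y = cinner x (B y)" by (rule positive_op_sa[OF B_pos])

lemma lo_nonneg: "0 \<le> lo" and hi_pos: "0 < hi" by (auto simp: lo_def hi_def)

lemma lo_pos: "lam \<noteq> 1 \<Longrightarrow> 0 < lo" using lam_ne by (auto simp: lo_def)

text \<open>The squares of \<open>lo\<close> and \<open>hi\<close> are those of
  \<open>(1 - lam) / 2\<close> and \<open>(1 + lam) / 2\<close>, in an order that depends on the
  sign of \<open>lam\<close>. Sum and product do not see the order.\<close>

lemma lo_hi_sum: "hi\<^sup>2 + lo\<^sup>2 = (lam\<^sup>2 + 1) / 2"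
  by (auto simp: lo_def hi_def power2_eq_square abs_if field_simps)

lemma lo_hi_prod: "hi\<^sup>2 * lo\<^sup>2 = ((lam\<^sup>2 - 1) / 4)\<^sup>2"
proof -
  have "lo\<^sup>2 = ((1 - \<bar>lam\<bar>) / 2)\<^sup>2" by (simp add: lo_def power_divide)
  then have "hi\<^sup>2 * lo\<^sup>2 = ((1 + \<bar>lam\<bar>) * (1 - \<bar>lam\<bar>) / 4)\<^sup>2"
    by (simp add: hi_def power_mult_distrib power_divide)
  also have "(1 + \<bar>lam\<bar>) * (1 - \<bar>lam\<bar>) = - (lam\<^sup>2 - 1)"
    by (simp add: algebra_simps power2_eq_square)
  also have "(- (lam\<^sup>2 - 1) / 4)\<^sup>2 = ((lam\<^sup>2 - 1) / 4)\<^sup>2"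
    by (simp only: minus_divide_left[symmetric] power2_minus)
  finally show ?thesis .
qed

lemma B_minus_lo_positive: "positive_op (\<lambda>x. B x - complex_of_real lo *\<^sub>C x)"
  and B_minus_lo_inj: "B x - complex_of_real lo *\<^sub>C x = 0 \<Longrightarrow> x = 0"
  and hi_minus_B_positive: "positive_op (\<lambda>x. complex_of_real hi *\<^sub>C x - B x)"
  and hi_minus_B_inj: "complex_of_real hi *\<^sub>C x - B x = 0 \<Longrightarrow> x = 0"
proof -
  have lower: "positive_op (\<lambda>x. B x - complex_of_real lo *\<^sub>C x)" "inj (\<lambda>x. B x - complex_of_real lo *\<^sub>C x)"
    using B_lower by (simp_all add: op_less_def scal_op_def lo_def hi_def)
  have upper: "positive_op (\<lambda>x. complex_of_real hi *\<^sub>C x - B x)" "inj (\<lambda>x. complex_of_real hi *\<^sub>C x - B x)"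
    using B_upper by (simp_all add: op_less_def scal_op_def lo_def hi_def)
  show "positive_op (\<lambda>x. B x - complex_of_real lo *\<^sub>C x)" by (rule lower)
  show "positive_op (\<lambda>x. complex_of_real hi *\<^sub>C x - B x)" by (rule upper)
  show "x = 0" if "B x - complex_of_real lo *\<^sub>C x = 0"
    using injD[OF lower(2), of x 0] that by (simp add: B_lin)
  show "x = 0" if "complex_of_real hi *\<^sub>C x - B x = 0"
    using injD[OF upper(2), of x 0] that by (simp add: B_lin)
qed

lemma B_lower_bound: "lo * (cnorm x)\<^sup>2 \<le> Re (cinner x (B x))"
  using positive_op_nonneg[OF B_minus_lo_positive, of x] by (simp add: cinner_simps cnorm_sq)

lemma B_norm_lower: "lo * cnorm x \<le> cnorm (B x)"
proof (cases "x = 0")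
  case False
  then have "cnorm x > 0" using cnorm_eq_0 cnorm_ge_0 by (metis order_le_less)
  moreover have "lo * cnorm x * cnorm x \<le> cnorm (B x) * cnorm x"
    using B_lower_bound[of x] cinner_cauchy_schwarz[of x "B x"] complex_Re_le_cmod[of "cinner x (B x)"]
    unfolding power2_eq_square mult.assoc mult.commute[of "cnorm (B x)"] by linarith
  ultimately show ?thesis by (rule mult_right_le_imp_le[rotated])
qed simp

text \<open>The norm bound settles \<open>lo > 0\<close>. If \<open>lo = 0\<close>, which happens
  only for \<open>lam = 1\<close>, injectivity is the strictness of the lower inequality.\<close>

lemma B_inj: "B x = 0 \<Longrightarrow> x = 0"
  using B_minus_lo_inj[of x] B_norm_lower[of x] cnorm_ge_0[of x] lo_nonneg
  by (cases "lo = 0") (auto simp: mult_le_0_iff)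

lemma
  assumes "lam \<noteq> 1"
  shows inverse_B_bounded: "bounded_op (op_inverse B)"
    and inverse_B_left: "op_inverse B (B x) = x"
    and inverse_B_right: "B (op_inverse B x) = x"
proof -
  note inverse = B_bounded B_sa lo_pos[OF assms] B_norm_lower
  show "bounded_op (op_inverse B)" by (rule op_inverse_bounded[OF inverse])
  show "op_inverse B (B x) = x" by (rule op_inverse_left[OF inverse])
  show "B (op_inverse B x) = x" by (rule op_inverse_right[OF inverse])
qed

lemma inverse_B_commute:
  assumes "lam \<noteq> 1" "\<And>x. Z (B x) = B (Z x)"
  shows "Z (op_inverse B x) = op_inverse B (Z x)"
  using assms(2)[of "op_inverse B x"] inverse_B_left[OF assms(1)] inverse_B_right[OF assms(1)] by metis

lemma inverse_B_sa:
  assumes "lam \<noteq> 1"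
  shows "cinner (op_inverse B x) y = cinner x (op_inverse B y)"
  using B_sa[of "op_inverse B x" "op_inverse B y"] inverse_B_right[OF assms] by simp

section \<open>The operator \<open>F\<close> in place of the inverse of \<open>B\<close>\<close>

lemma F_bounded: "bounded_op F"
proof (cases "lam = 1")
  case True
  then have "F = (\<lambda>x. 0)" by (simp add: inverse_part_def fun_eq_iff)
  then show ?thesis by simp
next
  case False
  then have "F = (\<lambda>x. kap *\<^sub>C op_inverse B x)" by (simp add: inverse_part_def fun_eq_iff)
  then show ?thesis using bounded_op_scaleC[OF inverse_B_bounded[OF False]] by simp
qed

lemmas F_lin = clinear_simps[OF bounded_op_clinear[OF F_bounded]]

lemma F_sa: "cinner (F x) y = cinner x (F y)"
  by (simp add: inverse_part_def cinner_simps inverse_B_sa)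

text \<open>For \<open>lam = 1\<close> both \<open>F\<close> and \<open>kap\<close> vanish, so these
  relations hold uniformly and later computations need no division by \<open>B\<close>.\<close>

lemma F_B: "F (B x) = kap *\<^sub>C x" and B_F: "B (F x) = kap *\<^sub>C x"
  by (auto simp: inverse_part_def B_lin inverse_B_left inverse_B_right)

lemma F_commute: "clinear Z \<Longrightarrow> (\<And>x. Z (B x) = B (Z x)) \<Longrightarrow> Z (F x) = F (Z x)"
  by (auto simp: inverse_part_def clinear_simps inverse_B_commute)

lemma inverse_B_lin:
  assumes "lam \<noteq> 1"
  shows "clinear (op_inverse B)"
  by (rule bounded_op_clinear[OF inverse_B_bounded[OF assms]])

lemma P11_eq: "P11 lam B x = complex_of_real lam *\<^sub>C x + B x + F x"
proof (cases "lam = 1")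
  case False
  show ?thesis
    by (rule cinner_ext)
      (simp add: False P11_def shift_def inverse_part_def B_lin clinear_simps[OF inverse_B_lin[OF False]]
        inverse_B_left[OF False] cinner_simps field_simps power2_eq_square)
qed (simp add: P11_def shift_def inverse_part_def)

lemma P22_eq: "P22 lam B x = complex_of_real lam *\<^sub>C x - B x - F x"
proof (cases "lam = 1")
  case False
  show ?thesis
    by (rule cinner_ext)
      (simp add: False P22_def neg_op_def shift_def inverse_part_def B_lin clinear_simps[OF inverse_B_lin[OF False]]
        inverse_B_left[OF False] cinner_simps field_simps power2_eq_square)
qed (simp add: P22_def shift_def inverse_part_def)

lemma Q11_eq: "Q11 lam B x = x + B x - F x"
proof (cases "lam = 1")
  case False
  show ?thesis
    by (rule cinner_ext)
      (simp add: False Q11_def shift_def inverse_part_def B_lin clinear_simps[OF inverse_B_lin[OF False]]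
        inverse_B_left[OF False] cinner_simps field_simps power2_eq_square)
qed (simp add: Q11_def shift_def inverse_part_def)

lemma Q22_eq: "Q22 lam B x = x - B x + F x"
proof (cases "lam = 1")
  case False
  show ?thesis
    by (rule cinner_ext)
      (simp add: False Q22_def neg_op_def shift_def inverse_part_def B_lin clinear_simps[OF inverse_B_lin[OF False]]
        inverse_B_left[OF False] cinner_simps field_simps power2_eq_square)
qed (simp add: Q22_def shift_def inverse_part_def)

text \<open>Factorization into \<open>hi - B\<close> and \<open>hi + B\<close>, commuting positive
  operators: the first is injective by the strict upper inequality, the second because
  \<open>hi\<close> is positive.\<close>

lemma
  shows upper_factor_positive: "positive_op (\<lambda>x. complex_of_real (hi\<^sup>2) *\<^sub>C x - B (B x))"
    and upper_factor_inj: "complex_of_real (hi\<^sup>2) *\<^sub>C x - B (B x) = 0 \<Longrightarrow> x = 0"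
proof -
  let ?U = "\<lambda>x. complex_of_real hi *\<^sub>C x - B x" and ?V = "\<lambda>x. complex_of_real hi *\<^sub>C x + B x"
  have V: "positive_op ?V"
    using hi_pos by (intro positive_op_add positive_op_scale positive_op_id B_pos) auto
  have eq: "?U (?V x) = complex_of_real (hi\<^sup>2) *\<^sub>C x - B (B x)" for x
    by (rule cinner_ext) (simp add: B_lin cinner_simps algebra_simps power2_eq_square)
  have "positive_op (\<lambda>x. ?U (?V x))"
    by (rule positive_op_commuting_product[OF hi_minus_B_positive V])
      (rule cinner_ext, simp add: B_lin cinner_simps algebra_simps)
  then show "positive_op (\<lambda>x. complex_of_real (hi\<^sup>2) *\<^sub>C x - B (B x))" by (simp only: eq)
  assume "complex_of_real (hi\<^sup>2) *\<^sub>C x - B (B x) = 0"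
  then have "?V x = 0" using hi_minus_B_inj[of "?V x"] unfolding eq by blast
  then have "Re (cinner x (?V x)) = 0" by simp
  then have "hi * (cnorm x)\<^sup>2 + Re (cinner x (B x)) = 0" by (simp add: cinner_simps cnorm_sq)
  moreover have "0 \<le> hi * (cnorm x)\<^sup>2" using hi_pos by simp
  ultimately have "hi * (cnorm x)\<^sup>2 = 0" using positive_op_nonneg[OF B_pos, of x] by linarith
  then show "x = 0" using hi_pos by simp
qed

text \<open>Factorization into \<open>B - lo\<close> and \<open>B + lo\<close>. The second factor
  may reduce to \<open>B\<close> itself when \<open>lo = 0\<close>, so its kernel is controlled
  through the kernel of \<open>B\<close>.\<close>

lemma
  shows lower_factor_positive: "positive_op (\<lambda>x. B (B x) - complex_of_real (lo\<^sup>2) *\<^sub>C x)"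
    and lower_factor_inj: "B (B x) - complex_of_real (lo\<^sup>2) *\<^sub>C x = 0 \<Longrightarrow> x = 0"
proof -
  let ?U = "\<lambda>x. B x - complex_of_real lo *\<^sub>C x" and ?V = "\<lambda>x. complex_of_real lo *\<^sub>C x + B x"
  have V: "positive_op ?V"
    using lo_nonneg by (intro positive_op_add positive_op_scale positive_op_id B_pos) auto
  have eq: "?U (?V x) = B (B x) - complex_of_real (lo\<^sup>2) *\<^sub>C x" for x
    by (rule cinner_ext) (simp add: B_lin cinner_simps algebra_simps power2_eq_square)
  have "positive_op (\<lambda>x. ?U (?V x))"
    by (rule positive_op_commuting_product[OF B_minus_lo_positive V])
      (rule cinner_ext, simp add: B_lin cinner_simps algebra_simps)
  then show "positive_op (\<lambda>x. B (B x) - complex_of_real (lo\<^sup>2) *\<^sub>C x)" by (simp only: eq)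
  assume "B (B x) - complex_of_real (lo\<^sup>2) *\<^sub>C x = 0"
  then have "?V x = 0" using B_minus_lo_inj[of "?V x"] unfolding eq by blast
  then have "Re (cinner x (?V x)) = 0" by simp
  then have "lo * (cnorm x)\<^sup>2 + Re (cinner x (B x)) = 0" by (simp add: cinner_simps cnorm_sq)
  moreover have "0 \<le> lo * (cnorm x)\<^sup>2" using lo_nonneg by simp
  ultimately have "Re (cinner x (B x)) = 0" using positive_op_nonneg[OF B_pos, of x] by linarith
  then show "x = 0" using positive_op_eq_0[OF B_pos] B_inj by blast
qed

lemma radicand_eq:
  assumes "lam \<noteq> 1"
  shows "R x = complex_of_real ((lam\<^sup>2 + 1) / 2) *\<^sub>C B (B x) - (kap * kap) *\<^sub>C x - B (B (B (B x)))"
  by (rule cinner_ext)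
    (simp add: assms radicand_def neg_op_def shift_def B_lin cinner_simps field_simps power2_eq_square)

text \<open>The expanded radicand depends only on the sum and the product of its two constants, so
  they may be renamed \<open>hi^2\<close> and \<open>lo^2\<close>. Then both factors
  \<open>hi^2 - B^2\<close> and \<open>B^2 - lo^2\<close> are positive and injective for either sign
  of \<open>lam\<close>.\<close>

lemma radicand_factor:
  assumes "lam \<noteq> 1"
  shows "R x = complex_of_real (hi\<^sup>2) *\<^sub>C (B (B x) - complex_of_real (lo\<^sup>2) *\<^sub>C x)
    - B (B (B (B x) - complex_of_real (lo\<^sup>2) *\<^sub>C x))"
proof (rule cinner_ext)
  fix z
  have "complex_of_real ((lam\<^sup>2 + 1) / 2) = complex_of_real (hi\<^sup>2) + complex_of_real (lo\<^sup>2)"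
    unfolding lo_hi_sum[symmetric] by simp
  moreover have "kap * kap = complex_of_real (hi\<^sup>2) * complex_of_real (lo\<^sup>2)"
    using arg_cong[OF lo_hi_prod, of complex_of_real] by (simp only: of_real_mult power2_eq_square)
  ultimately show "cinner z (R x) = cinner z (complex_of_real (hi\<^sup>2) *\<^sub>C (B (B x) - complex_of_real (lo\<^sup>2) *\<^sub>C x)
    - B (B (B (B x) - complex_of_real (lo\<^sup>2) *\<^sub>C x)))"
    unfolding radicand_eq[OF assms] by (simp only: B_lin cinner_simps) (simp only: algebra_simps)
qed

lemma radicand_positive: "positive_op R"
proof (cases "lam = 1")
  case True
  have "complex_of_real (hi\<^sup>2) = 1" using True unfolding hi_def by simp
  then show ?thesis using True upper_factor_positive by (simp add: radicand_def[abs_def])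
next
  case False
  then have "R = (\<lambda>x. complex_of_real (hi\<^sup>2) *\<^sub>C (B (B x) - complex_of_real (lo\<^sup>2) *\<^sub>C x)
    - B (B (B (B x) - complex_of_real (lo\<^sup>2) *\<^sub>C x)))"
    using radicand_factor by blast
  moreover have "positive_op (\<lambda>x. complex_of_real (hi\<^sup>2) *\<^sub>C (B (B x) - complex_of_real (lo\<^sup>2) *\<^sub>C x)
    - B (B (B (B x) - complex_of_real (lo\<^sup>2) *\<^sub>C x)))"
    by (rule positive_op_commuting_product[OF upper_factor_positive lower_factor_positive])
      (rule cinner_ext, simp only: B_lin cinner_simps, simp only: algebra_simps)
  ultimately show ?thesis by (simp only:)
qed

lemma radicand_inj: "R x = 0 \<Longrightarrow> x = 0"
proof (cases "lam = 1")
  case True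
  then have "complex_of_real (hi\<^sup>2) = 1" unfolding hi_def by simp
  moreover assume "R x = 0"
  ultimately show "x = 0" using True upper_factor_inj[of x] by (simp add: radicand_def)
next
  case False
  assume "R x = 0"
  then show "x = 0"
    unfolding radicand_factor[OF False] by (rule lower_factor_inj[OF upper_factor_inj])
qed

lemma radicand_commute:
  assumes "clinear Z" "\<And>x. Z (B x) = B (Z x)"
  shows "Z (R x) = R (Z x)"
proof (cases "lam = 1")
  case True
  then show ?thesis by (simp add: radicand_def clinear_simps[OF assms(1)] assms(2))
next
  case False
  then show ?thesis by (simp add: radicand_eq clinear_simps[OF assms(1)] assms(2))
qed

lemma sqrt_radicand_commute:
  assumes "bounded_op Z" "\<And>x. Z (B x) = B (Z x)"
  shows "Z (op_sqrt R x) = op_sqrt R (Z x)"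
  by (rule op_sqrt_commute[OF radicand_positive assms(1)])
    (rule radicand_commute[OF bounded_op_clinear[OF assms(1)] assms(2)])

lemma inverse_sqrt_radicand:
  "lam \<noteq> 1 \<Longrightarrow> op_inverse B (op_sqrt R x) = op_sqrt R (op_inverse B x)"
  by (rule sqrt_radicand_commute[OF inverse_B_bounded]) (auto simp: inverse_B_left inverse_B_right)

lemma sqrt_radicand_bounded: "bounded_op (op_sqrt R)"
  by (rule positive_op_bounded[OF op_sqrt_positive[OF radicand_positive]])

section \<open>The off-diagonal entry \<open>N\<close>, the Sylvester equation and the polar
  decomposition\<close>

lemma N_if_one: "lam = 1 \<Longrightarrow> N x = op_sqrt R x"
  and N_if_not_one: "lam \<noteq> 1 \<Longrightarrow> N x = op_inverse B (op_sqrt R x)"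
  by (simp_all add: P12_eq)

lemma N_bounded: "bounded_op N"
proof (cases "lam = 1")
  case True
  have "N = op_sqrt R" by (rule ext) (rule N_if_one[OF True])
  then show ?thesis using sqrt_radicand_bounded by metis
next
  case False
  have "N = (\<lambda>x. op_inverse B (op_sqrt R x))" by (rule ext) (rule N_if_not_one[OF False])
  then show ?thesis
    using bounded_op_compose[OF inverse_B_bounded[OF False] sqrt_radicand_bounded] by metis
qed

lemmas N_lin = clinear_simps[OF bounded_op_clinear[OF N_bounded]]

lemma N_sa: "cinner (N x) y = cinner x (N y)"
proof (cases "lam = 1")
  case True
  show ?thesis
    unfolding N_if_one[OF True] by (rule positive_op_sa[OF op_sqrt_positive[OF radicand_positive]])
next
  case False
  show ?thesis
    unfolding N_if_not_one[OF False]
    by (simp add: positive_op_sa[OF op_sqrt_positive[OF radicand_positive]] inverse_B_sa[OF False]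
        inverse_sqrt_radicand[OF False])
qed

lemma N_commute:
  assumes "bounded_op Z" "\<And>x. Z (B x) = B (Z x)"
  shows "Z (N x) = N (Z x)"
proof (cases "lam = 1")
  case True
  show ?thesis unfolding N_if_one[OF True] by (rule sqrt_radicand_commute[OF assms])
next
  case False
  show ?thesis
    using sqrt_radicand_commute[OF assms] inverse_B_commute[where Z = Z, OF False assms(2)]
    unfolding N_if_not_one[OF False] by simp
qed

text \<open>Applying the inverse of \<open>B\<close> twice to the expanded radicand leaves its
  middle coefficient as the scalar and turns the constant term \<open>kap^2\<close> into
  \<open>F^2\<close>. At \<open>lam = 1\<close> the formula reads \<open>1 - B^2\<close>.\<close>

lemma N_square: "N (N x) = complex_of_real ((lam\<^sup>2 + 1) / 2) *\<^sub>C x - B (B x) - F (F x)"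
proof (cases "lam = 1")
  case True
  then show ?thesis
    using op_sqrt_square[OF radicand_positive, of x] by (simp add: P12_eq radicand_def inverse_part_def)
next
  case False
  have "N (N x) = op_inverse B (op_inverse B (op_sqrt R (op_sqrt R x)))"
    by (simp only: N_if_not_one[OF False] inverse_sqrt_radicand[OF False])
  then have "N (N x) = op_inverse B (op_inverse B (R x))"
    by (simp only: op_sqrt_square[OF radicand_positive])
  then show ?thesis
    by (simp add: False radicand_eq clinear_simps[OF inverse_B_lin[OF False]] inverse_B_left inverse_part_def
        scaleC_scaleC algebra_simps)
qed

lemma N_inj: "N x = 0 \<Longrightarrow> x = 0"
proof -
  assume "N x = 0"
  then have "op_sqrt R x = 0"
    using inverse_B_right[of "op_sqrt R x"] by (auto simp: P12_eq B_lin split: if_splits)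
  then have "op_sqrt R (op_sqrt R x) = 0"
    by (simp add: clinear_zero[OF bounded_op_clinear[OF sqrt_radicand_bounded]])
  then show ?thesis using radicand_inj by (simp add: op_sqrt_square[OF radicand_positive])
qed

text \<open>Anticommuting twice means commuting with \<open>B^2\<close>, hence with its positive
  root \<open>B\<close>. Then \<open>2 B Z = 0\<close>, and injectivity of \<open>B\<close> is
  enough even when \<open>B\<close> has no bounded inverse.\<close>

lemma sylvester_zero:
  assumes Z: "bounded_op Z" and anti: "\<And>x. B (Z x) + Z (B x) = 0"
  shows "Z x = 0"
proof -
  have BZ: "B (Z x) = - Z (B x)" for x using anti[of x] by (simp add: eq_neg_iff_add_eq_0)
  then have "Z (B (B x)) = B (B (Z x))" for x by (simp add: B_lin)
  then have "Z (B x) = B (Z x)" by (rule commute_if_commute_square[OF B_pos Z])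
  then have "B (Z x) + B (Z x) = 0" using anti[of x] by simp
  then have "B (2 *\<^sub>C Z x) = 0" using cv.scale_left_distrib[of 1 1 "B (Z x)"] by (simp add: B_lin)
  then show "Z x = 0" using B_inj[of "2 *\<^sub>C Z x"] by simp
qed

text \<open>The vector \<open>z\<close> is to be the value at \<open>x\<close> of the unitary factor
  of \<open>C\<close>. With \<open>x\<close> approximated by \<open>N y_n\<close>, the vectors
  \<open>C y_n\<close> converge because \<open>C\<close> and \<open>N\<close> have equal norms on
  each vector, and their limit is \<open>z\<close>. Commuting with \<open>B\<close> makes
  \<open>C\<close> commute with \<open>N\<close>, which gives \<open>N z = C x\<close>.\<close>

lemma polar_exists:
  assumes C: "bounded_op C" "\<And>x y. cinner (C x) y = cinner x (D y)" "\<And>x. C (B x) = B (C x)"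
    and DC: "\<And>x. D (C x) = N (N x)"
  shows "\<exists>z. N z = C x \<and> cnorm z = cnorm x"
proof -
  note C_lin = clinear_simps[OF bounded_op_clinear[OF C(1)]]
  have norm: "cnorm (C y) = cnorm (N y)" for y
    using C(2)[of y "C y"] N_sa[of y "N y"] by (simp add: cnorm_def DC)
  have "csubspace (range N)"
    unfolding csubspace_def
  proof (intro conjI ballI allI)
    show "0 \<in> range N" by (metis N_lin(3) rangeI)
    show "u + v \<in> range N" if "u \<in> range N" "v \<in> range N" for u v
      using that by (auto simp flip: N_lin(1))
    show "a *\<^sub>C u \<in> range N" if "u \<in> range N" for a u
      using that by (auto simp flip: N_lin(2))
  qed
  moreover have "x = 0" if "\<And>m. m \<in> range N \<Longrightarrow> cinner m x = 0" for x
  proof -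
    have "N x = 0" using that[of "N (N x)"] N_sa[of "N x" x] cinner_eq_zero[of "N x"] by simp
    then show ?thesis by (rule N_inj)
  qed
  ultimately have "\<exists>X. (\<forall>n. X n \<in> range N) \<and> ctendsto X x"
    by (rule dense_if_orthogonal_trivial)
  then obtain X where X: "\<forall>n. X n \<in> range N" "ctendsto X x" by blast
  have "\<exists>z. X n = N z" for n using X(1) by blast
  then obtain Y where Y: "\<And>n. X n = N (Y n)" by metis
  obtain z where z: "ctendsto (\<lambda>n. C (Y n)) z"
  proof (rule ctendsto_dominated[OF X(2), of "\<lambda>n. C (Y n)" 1])
    show "cnorm (C (Y m) - C (Y n)) \<le> 1 * cnorm (X m - X n)" for m n
      using norm[of "Y m - Y n"] by (simp add: Y N_lin C_lin)
  qed simp_all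
  have "ctendsto (\<lambda>n. N (C (Y n))) (N z)" by (rule ctendsto_bounded_op[OF N_bounded z])
  moreover have "N (C (Y n)) = C (X n)" for n
    unfolding Y by (rule N_commute[OF C(1,3), symmetric])
  ultimately have "ctendsto (\<lambda>n. C (X n)) (N z)" by simp
  then have "N z = C x" using ctendsto_bounded_op[OF C(1) X(2)] by (rule ctendsto_unique)
  moreover have "(\<lambda>n. cnorm (X n)) \<longlonglongrightarrow> cnorm z"
    using ctendsto_cnorm[OF z] by (simp add: norm Y)
  then have "cnorm z = cnorm x" using ctendsto_cnorm[OF X(2)] by (rule LIMSEQ_unique)
  ultimately show ?thesis by blast
qed

text \<open>The construction for \<open>C\<close> gives an isometry \<open>U\<close>; running it for
  the adjoint \<open>D\<close> gives a right inverse \<open>V\<close> of \<open>U\<close>, so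
  \<open>U\<close> is onto and \<open>V\<close> is its adjoint. All identities are checked after
  applying the injective \<open>N\<close>.\<close>

lemma polar_decomposition:
  assumes C: "bounded_op C" "\<And>x. C (B x) = B (C x)" and D: "bounded_op D" "\<And>x. D (B x) = B (D x)"
    and CD: "\<And>x y. cinner (C x) y = cinner x (D y)" "\<And>x. D (C x) = N (N x)" "\<And>x. C (D x) = N (N x)"
  obtains U where "unitary U" "U \<circ> B = B \<circ> U" "\<And>x. C x = N (U x)" "\<And>x. D x = adjoint U (N x)"
proof -
  note C_lin = clinear_simps[OF bounded_op_clinear[OF C(1)]]
  have DC: "cinner (D x) y = cinner x (C y)" for x y
    using CD(1)[of y x] cinner_conj[of "D x" y] cinner_conj[of x "C y"] by simp
  obtain U where U: "\<And>x. N (U x) = C x" "\<And>x. cnorm (U x) = cnorm x"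
    using polar_exists[OF C(1) CD(1) C(2) CD(2)] by metis
  obtain V where V: "\<And>x. N (V x) = D x"
    using polar_exists[OF D(1) DC D(2) CD(3)] by metis
  have N_eqD: "x = y" if "N x = N y" for x y
    using N_inj[of "x - y"] that by (simp add: N_lin)
  have lin: "clinear U"
    unfolding clinear_def by (intro conjI allI; rule N_eqD) (simp_all add: N_lin U C_lin)
  have iso: "cinner (U x) (U y) = cinner x y" for x y
    using isometry_cinner[OF lin U(2)] .
  \<comment> \<open>\<open>N\<close> is cancelled twice: one copy turns \<open>U\<close> into
    \<open>C\<close>, the other is moved past \<open>C\<close> to turn \<open>V\<close> into
    \<open>D\<close>.\<close>
  have UV: "U (V x) = x" for x
  proof (rule N_eqD, rule N_eqD)
    have "N (N (U (V x))) = C (N (V x))" by (simp add: U N_commute[OF C])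
    then show "N (N (U (V x))) = N (N x)" by (simp add: V CD(3))
  qed
  have unit: "unitary U"
    unfolding unitary_def using bounded_opI[of U 1] lin U(2) iso UV by (metis mult_1 order_refl surjI)
  have adj: "adjoint U = V"
    by (rule adjoint_eqI) (metis iso UV)
  have "U (B x) = B (U x)" for x
    by (rule N_eqD) (simp add: U C(2) N_commute[OF B_bounded, symmetric])
  then have "U \<circ> B = B \<circ> U" by auto
  moreover have "D x = V (N x)" for x
    by (rule N_eqD) (simp add: V N_commute[OF D, symmetric])
  ultimately show ?thesis using that[of U] unit U(1) adj by simp
qed

text \<open>The \<open>g\<close>s are the blocks of the operator \<open>G\<close> described at the beginning.\<close>

lemma block_solution:
  assumes bdd: "bounded_op g11" "bounded_op g12" "bounded_op g21" "bounded_op g22"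
    and adj: "\<And>x y. cinner (g12 x) y = cinner x (g21 y)"
    and anti: "\<And>x. B (g11 x) + g11 (B x) = (2 * kap) *\<^sub>C x" "\<And>x. B (g22 x) + g22 (B x) = - ((2 * kap) *\<^sub>C x)"
      "\<And>x. g12 (B x) = B (g12 x)" "\<And>x. g21 (B x) = B (g21 x)"
    and sq: "\<And>x. B (B x) + g11 (g11 x) + g12 (g21 x) = complex_of_real ((lam\<^sup>2 + 1) / 2) *\<^sub>C x"
      "\<And>x. B (B x) + g22 (g22 x) + g21 (g12 x) = complex_of_real ((lam\<^sup>2 + 1) / 2) *\<^sub>C x"
  obtains U where "unitary U" "U \<circ> B = B \<circ> U" "\<And>x. g11 x = F x" "\<And>x. g22 x = - F x"
    "\<And>x. g12 x = N (U x)" "\<And>x. g21 x = adjoint U (N x)"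
proof -
  have two: "(2 * kap) *\<^sub>C x = kap *\<^sub>C x + kap *\<^sub>C x" for x :: 'b
    by (simp only: mult_2 scaleC_add_left)
  \<comment> \<open>\<open>F\<close> is a particular solution, since \<open>B F\<close> and
    \<open>F B\<close> both equal \<open>kap\<close>; the difference solves the homogeneous
    equation.\<close>
  have "B (g11 x - F x) + (g11 (B x) - F (B x)) = B (g11 x) + g11 (B x) - (kap *\<^sub>C x + kap *\<^sub>C x)" for x
    by (simp only: B_lin F_B B_F) simp
  then have "B (g11 x - F x) + (g11 (B x) - F (B x)) = 0" for x
    by (simp only: anti two) simp
  then have "g11 x - F x = 0" for x
    by (rule sylvester_zero[of "\<lambda>x. g11 x - F x", OF bounded_op_diff[OF bdd(1) F_bounded]])
  then have g11: "g11 x = F x" for x by simp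
  have "B (g22 x + F x) + (g22 (B x) + F (B x)) = B (g22 x) + g22 (B x) + (kap *\<^sub>C x + kap *\<^sub>C x)" for x
    by (simp only: B_lin F_B B_F) simp
  then have "B (g22 x + F x) + (g22 (B x) + F (B x)) = 0" for x
    by (simp only: anti two) simp
  then have "g22 x + F x = 0" for x
    by (rule sylvester_zero[of "\<lambda>x. g22 x + F x", OF bounded_op_add[OF bdd(4) F_bounded]])
  then have g22: "g22 x = - F x" for x by (simp add: eq_neg_iff_add_eq_0)
  have "g12 (g21 x) = N (N x)" "g21 (g12 x) = N (N x)" for x
    unfolding N_square using sq[of x] by (simp_all add: g11 g22 F_lin algebra_simps)
  then obtain U where "unitary U" "U \<circ> B = B \<circ> U" "\<And>x. g12 x = N (U x)" "\<And>x. g21 x = adjoint U (N x)"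
    using polar_decomposition[OF bdd(2) anti(3) bdd(3) anti(4) adj] by metis
  then show ?thesis using that[of U] g11 g22 by blast
qed

section \<open>Identities for the blocks of \<open>P_U\<close> and \<open>Q_U\<close>\<close>

lemma F_N: "F (N x) = N (F x)"
  by (rule F_commute[OF bounded_op_clinear[OF N_bounded], symmetric])
    (rule N_commute[OF B_bounded, symmetric, OF refl])

lemma B_N: "B (N x) = N (B x)"
  by (rule N_commute[OF B_bounded]) (rule refl)

text \<open>The blocks are written through \<open>F\<close> instead of the inverse of
  \<open>B\<close>, so that one computation covers \<open>lam = 1\<close> as well.\<close>

abbreviation PU11 :: "'b \<Rightarrow> 'b" where
  "PU11 x \<equiv> complex_of_real (1 / (2 * lam)) *\<^sub>C (complex_of_real lam *\<^sub>C x + B x + F x)"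
abbreviation PU22 :: "'b \<Rightarrow> 'b" where
  "PU22 x \<equiv> complex_of_real (1 / (2 * lam)) *\<^sub>C (complex_of_real lam *\<^sub>C x - B x - F x)"
abbreviation QU11 :: "'b \<Rightarrow> 'b" where
  "QU11 x \<equiv> complex_of_real (1 / 2) *\<^sub>C (x + B x - F x)"
abbreviation QU22 :: "'b \<Rightarrow> 'b" where
  "QU22 x \<equiv> complex_of_real (1 / 2) *\<^sub>C (x - B x + F x)"

context
  fixes U
  assumes U: "unitary U" "U \<circ> B = B \<circ> U"
begin

lemmas U_lin = clinear_simps[OF bounded_op_clinear[OF unitary_bounded[OF U(1)]]]
lemmas adjoint_U_lin = clinear_simps[OF bounded_op_clinear[OF bounded_op_adjoint_unitary[OF U(1)]]]
lemmas U_adjoint = adjoint_unitary_left[OF U(1)] adjoint_unitary_right[OF U(1)]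

lemma B_U: "B (U x) = U (B x)"
  using fun_cong[OF U(2), of x] by simp

lemma B_adjoint_U: "B (adjoint U x) = adjoint U (B x)"
  using B_U[of "adjoint U x"] U_adjoint by metis

lemma F_U: "F (U x) = U (F x)"
  by (rule F_commute[OF bounded_op_clinear[OF unitary_bounded[OF U(1)]], symmetric]) (rule B_U[symmetric])

lemma F_adjoint_U: "F (adjoint U x) = adjoint U (F x)"
  by (rule F_commute[OF bounded_op_clinear[OF bounded_op_adjoint_unitary[OF U(1)]], symmetric])
    (rule B_adjoint_U[symmetric])

lemmas block_rules = B_lin F_lin N_lin U_lin adjoint_U_lin U_adjoint B_U B_adjoint_U F_U F_adjoint_U
  F_N B_N F_B B_F N_square

abbreviation PU12 :: "'b \<Rightarrow> 'b" where
  "PU12 x \<equiv> complex_of_real (1 / (2 * lam)) *\<^sub>C N (U x)"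
abbreviation PU21 :: "'b \<Rightarrow> 'b" where
  "PU21 x \<equiv> complex_of_real (1 / (2 * lam)) *\<^sub>C adjoint U (N x)"
abbreviation QU12 :: "'b \<Rightarrow> 'b" where
  "QU12 x \<equiv> complex_of_real (1 / 2) *\<^sub>C (- N (U x))"
abbreviation QU21 :: "'b \<Rightarrow> 'b" where
  "QU21 x \<equiv> complex_of_real (1 / 2) *\<^sub>C (- adjoint U (N x))"

lemma P_U_eq: "P_U lam B U (x, y) = (PU11 x + PU12 y, PU21 x + PU22 y)"
  by (simp add: P_U_def block_op_def P11_eq P22_eq scaleC_add_right)

lemma Q_U_eq: "Q_U lam B U (x, y) = (QU11 x + QU12 y, QU21 x + QU22 y)"
  by (simp add: Q_U_def block_op_def Q11_eq Q22_eq Q12_def neg_op_def scaleC_add_right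
      cv.scale_right_diff_distrib adjoint_U_lin)

lemma block_bounded:
  "bounded_op PU11" "bounded_op PU12" "bounded_op PU21" "bounded_op PU22"
  "bounded_op QU11" "bounded_op QU12" "bounded_op QU21" "bounded_op QU22"
proof -
  have NU: "bounded_op (\<lambda>x. N (U x))" and UN: "bounded_op (\<lambda>x. adjoint U (N x))"
    by (rule bounded_op_compose[OF N_bounded unitary_bounded[OF U(1)]]
        bounded_op_compose[OF bounded_op_adjoint_unitary[OF U(1)] N_bounded])+
  show "bounded_op PU11" "bounded_op PU12" "bounded_op PU21" "bounded_op PU22"
    "bounded_op QU11" "bounded_op QU12" "bounded_op QU21" "bounded_op QU22"
    by (intro bounded_op_intros B_bounded F_bounded NU UN)+
qed

lemma block_sa:
  "cinner (PU11 x) y = cinner x (PU11 y)" "cinner (PU22 x) y = cinner x (PU22 y)"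
  "cinner (PU12 x) y = cinner x (PU21 y)" "cinner (QU11 x) y = cinner x (QU11 y)"
  "cinner (QU22 x) y = cinner x (QU22 y)" "cinner (QU12 x) y = cinner x (QU21 y)"
  by (simp_all add: cinner_simps B_sa F_sa N_sa unitary_adjoint[OF U(1)])

text \<open>The diagonal identities rest on \<open>(B + F)^2 + N^2 = lam^2\<close>: the cross term
  \<open>2 kap = (lam^2 - 1) / 2\<close> is added to the scalar \<open>(lam^2 + 1) / 2\<close> of
  \<open>N^2\<close>. In the off-diagonal ones \<open>B + F\<close> occurs with both signs and
  cancels.\<close>

lemma PU_idempotent:
  "PU11 (PU11 x) + PU12 (PU21 x) = PU11 x" "PU11 (PU12 x) + PU12 (PU22 x) = PU12 x"
  "PU21 (PU11 x) + PU22 (PU21 x) = PU21 x" "PU21 (PU12 x) + PU22 (PU22 x) = PU22 x"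
proof -
  have lam: "complex_of_real lam \<noteq> 0" using lam_ne by simp
  show "PU11 (PU11 x) + PU12 (PU21 x) = PU11 x" "PU11 (PU12 x) + PU12 (PU22 x) = PU12 x"
    "PU21 (PU11 x) + PU22 (PU21 x) = PU21 x" "PU21 (PU12 x) + PU22 (PU22 x) = PU22 x"
    by (rule cinner_ext, use lam in \<open>simp add: block_rules cinner_simps field_simps power2_eq_square\<close>)+
qed

text \<open>Here the cross term has the opposite sign, which gives
  \<open>(B - F)^2 + N^2 = 1\<close>.\<close>

lemma QU_idempotent:
  "QU11 (QU11 x) + QU12 (QU21 x) = QU11 x" "QU11 (QU12 x) + QU12 (QU22 x) = QU12 x"
  "QU21 (QU11 x) + QU22 (QU21 x) = QU21 x" "QU21 (QU12 x) + QU22 (QU22 x) = QU22 x"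
  by (rule cinner_ext, simp add: block_rules cinner_simps field_simps power2_eq_square)+

lemma block_sum:
  "complex_of_real lam *\<^sub>C (PU11 x + PU12 y) + (QU11 x + QU12 y) = complex_of_real ((1 + lam) / 2) *\<^sub>C x + B x"
  "complex_of_real lam *\<^sub>C (PU21 x + PU22 y) + (QU21 x + QU22 y) = complex_of_real ((1 + lam) / 2) *\<^sub>C y - B y"
proof -
  have lam: "complex_of_real lam \<noteq> 0" using lam_ne by simp
  show "complex_of_real lam *\<^sub>C (PU11 x + PU12 y) + (QU11 x + QU12 y) = complex_of_real ((1 + lam) / 2) *\<^sub>C x + B x"
    "complex_of_real lam *\<^sub>C (PU21 x + PU22 y) + (QU21 x + QU22 y) = complex_of_real ((1 + lam) / 2) *\<^sub>C y - B y"
    by (rule cinner_ext, use lam in \<open>simp add: cinner_simps field_simps\<close>)+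
qed

end

end

subsection \<open>Pairs of projections\<close>

lemma clinear_sum: "clinear f \<Longrightarrow> f (\<Sum>i\<in>I. g i) = (\<Sum>i\<in>I. f (g i))"
  by (induction I rule: infinite_finite_induct) (simp_all add: clinear_zero clinear_add)

lemma cinner_sum_right: "cinner x (\<Sum>i\<in>I. g i) = (\<Sum>i\<in>I. cinner x (g i))"
  by (induction I rule: infinite_finite_induct) (simp_all add: cinner_add_right)

lemma csubspace_orth_compl: "csubspace (orth_compl S)"
  by (simp add: csubspace_def orth_compl_def cinner_simps)

lemma cclosed_orth_compl: "cclosed (orth_compl S)"
  unfolding cclosed_def orth_compl_def
proof (intro allI impI CollectI ballI)
  fix X L y assume X: "\<forall>n. X n \<in> {x. \<forall>y\<in>S. cinner y x = 0}" "ctendsto X L" "y \<in> S"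
  have "(\<lambda>n. cinner y (X n)) \<longlonglongrightarrow> cinner y L" by (rule ctendsto_cinner[OF X(2)])
  moreover have "cinner y (X n) = 0" for n using X(1,3) by blast
  ultimately show "cinner y L = 0" by (simp add: LIMSEQ_const_iff)
qed

lemma is_projection_add:
  assumes "is_projection P" "is_projection Q" "\<And>x. P (Q x) = 0"
  shows "is_projection (\<lambda>x. P x + Q x)"
proof (rule is_projectionI)
  show "bounded_op (\<lambda>x. P x + Q x)"
    by (intro bounded_op_add is_projection_bounded assms)
  show "cinner (P x + Q x) y = cinner x (P y + Q y)" for x y
    by (simp add: cinner_simps is_projection_sa[OF assms(1)] is_projection_sa[OF assms(2)])
  have "Q (P x) = 0" for x
  proof (rule cinner_ext)
    show "cinner z (Q (P x)) = cinner z 0" for z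
      using is_projection_sa[OF assms(2), of z "P x"] is_projection_sa[OF assms(1), of "Q z" x] assms(3)
      by simp
  qed
  then show "P (P x + Q x) + Q (P x + Q x) = P x + Q x" for x
    by (simp add: clinear_simps[OF is_projection_clinear[OF assms(1)]]
        clinear_simps[OF is_projection_clinear[OF assms(2)]]
        is_projection_idem[OF assms(1)] is_projection_idem[OF assms(2)] assms(3))
qed

lemma is_projection_complement:
  assumes "is_projection P"
  shows "is_projection (\<lambda>x. x - P x)"
  by (rule is_projectionI)
    (simp_all add: bounded_op_diff is_projection_bounded[OF assms] cinner_simps
      is_projection_sa[OF assms] clinear_simps[OF is_projection_clinear[OF assms]]
      is_projection_idem[OF assms])

text \<open>The form of a projection is the squared norm of the image. Inserting
  \<open>Q x = - mu P x\<close> gives \<open>mu^2 |P x|^2 = - mu |P x|^2\<close>, so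
  \<open>mu (mu + 1) |P x|^2 = 0\<close>.\<close>

lemma
  assumes P: "is_projection P" and Q: "is_projection Q" and mu: "mu \<noteq> 0" "mu \<noteq> -1"
    and zero: "complex_of_real mu *\<^sub>C P x + Q x = 0"
  shows projection_combination_zero_left: "P x = 0"
    and projection_combination_zero_right: "Q x = 0"
proof -
  have Qx: "Q x = - (complex_of_real mu *\<^sub>C P x)"
    using zero by (simp add: eq_neg_iff_add_eq_0 add.commute)
  have "cinner x (P x) = cinner (P x) (P x)"
    using is_projection_sa[OF P, of x "P x"] is_projection_idem[OF P] by simp
  moreover have "cinner x (Q x) = cinner (Q x) (Q x)"
    using is_projection_sa[OF Q, of x "Q x"] is_projection_idem[OF Q] by simp
  ultimately have "complex_of_real (mu * (mu + 1)) * cinner (P x) (P x) = 0"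
    unfolding Qx by (simp add: cinner_simps algebra_simps neg_eq_iff_add_eq_0)
  moreover have "mu * (mu + 1) \<noteq> 0" using mu by (auto simp: add_eq_0_iff)
  ultimately have "cinner (P x) (P x) = 0" by (simp del: of_real_mult of_real_add)
  then show "P x = 0" by (rule cinner_eq_zero)
  then show "Q x = 0" by (simp add: Qx)
qed

locale generic_decomposition = generic_block lam B
  for lam :: real and B :: "'b::chilbert_space \<Rightarrow> 'b" +
  fixes T :: "'a::chilbert_space \<Rightarrow> 'a" and J1 J2 :: "'b \<Rightarrow> 'a"
  assumes T: "selfadjoint T"
    and W: "unitary_sum_onto J1 J2 (generic_space T lam)"
    and T_J1: "T (J1 k) = complex_of_real ((1 + lam) / 2) *\<^sub>C J1 k + J1 (B k)"
    and T_J2: "T (J2 k) = complex_of_real ((1 + lam) / 2) *\<^sub>C J2 k - J2 (B k)"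
begin

abbreviation eigenspace :: "real \<Rightarrow> 'a set" where
  "eigenspace r \<equiv> kernel (shift T r)"

abbreviation proj :: "real \<Rightarrow> 'a \<Rightarrow> 'a" where
  "proj r \<equiv> orth_proj (eigenspace r)"

text \<open>A set rather than a list of four values: for \<open>lam = 1\<close> the two equal
  eigenvalues merge, and sums over \<open>eigs\<close> count their common eigenspace once.\<close>

abbreviation eigs :: "real set" where
  "eigs \<equiv> {0, 1, lam, 1 + lam}"

abbreviation A1 :: "'a \<Rightarrow> 'b" where "A1 \<equiv> adjoint J1"
abbreviation A2 :: "'a \<Rightarrow> 'b" where "A2 \<equiv> adjoint J2"

section \<open>Eigenspaces of \<open>T\<close> and the generic space\<close>

lemma T_bounded: "bounded_op T" using T by (simp add: selfadjoint_def)
lemmas T_lin = clinear_simps[OF bounded_op_clinear[OF T_bounded]]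
lemma T_sa: "cinner (T x) y = cinner x (T y)" using T by (simp add: selfadjoint_def)

lemma eigenspace_iff: "x \<in> eigenspace r \<longleftrightarrow> T x = complex_of_real r *\<^sub>C x"
  by (simp add: kernel_def shift_def)

lemma bounded_shift: "bounded_op (shift T r)"
  unfolding shift_def by (intro bounded_op_intros T_bounded)

lemma eigenspace_subspace: "csubspace (eigenspace r)"
  by (rule csubspace_kernel[OF bounded_op_clinear[OF bounded_shift]])

lemma eigenspace_closed: "cclosed (eigenspace r)"
  by (rule cclosed_kernel[OF bounded_shift])

lemma eigenspace_orth:
  assumes "r \<noteq> s" "x \<in> eigenspace r" "y \<in> eigenspace s"
  shows "cinner x y = 0"
  using T_sa[of x y] assms by (simp add: eigenspace_iff cinner_simps)

lemma proj_projection: "is_projection (proj r)"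
  by (rule is_projection_orth_proj[OF eigenspace_subspace eigenspace_closed])

lemma proj_in: "proj r x \<in> eigenspace r"
  by (rule orth_proj_in[OF eigenspace_subspace eigenspace_closed])

lemma proj_orth: "m \<in> eigenspace r \<Longrightarrow> cinner m (x - proj r x) = 0"
  by (rule orth_proj_orth[OF eigenspace_subspace eigenspace_closed])

lemma proj_ident: "x \<in> eigenspace r \<Longrightarrow> proj r x = x"
  by (rule orth_proj_ident[OF eigenspace_subspace])

lemma T_proj: "T (proj r x) = complex_of_real r *\<^sub>C proj r x"
  using proj_in by (simp add: eigenspace_iff)

lemma proj_proj: "r \<noteq> s \<Longrightarrow> proj r (proj s x) = 0"
  by (rule orth_proj_orthogonal[OF eigenspace_subspace]) (blast intro: eigenspace_orth proj_in)

lemma generic_space_iff: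
  "x \<in> generic_space T lam \<longleftrightarrow> (\<forall>r\<in>eigs. \<forall>m\<in>eigenspace r. cinner m x = 0)"
proof
  have 0: "0 \<in> eigenspace r" for r by (simp add: eigenspace_iff T_lin)
  have T0: "kernel T = eigenspace 0" by (auto simp: kernel_def shift_def)
  assume x: "x \<in> generic_space T lam"
  have *: "cinner (a + b + c + d) x = 0"
    if "a \<in> eigenspace 0" "b \<in> eigenspace 1" "c \<in> eigenspace lam" "d \<in> eigenspace (1 + lam)" for a b c d
    using x that unfolding generic_space_def orth_compl_def T0 by blast
  show "\<forall>r\<in>eigs. \<forall>m\<in>eigenspace r. cinner m x = 0"
    using *[OF _ 0 0 0] *[OF 0 _ 0 0] *[OF 0 0 _ 0] *[OF 0 0 0] by auto
next
  have T0: "kernel T = eigenspace 0" by (auto simp: kernel_def shift_def)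
  assume "\<forall>r\<in>eigs. \<forall>m\<in>eigenspace r. cinner m x = 0"
  then show "x \<in> generic_space T lam"
    unfolding generic_space_def orth_compl_def T0 by (auto simp: cinner_add_left)
qed

section \<open>Coordinates on the generic space\<close>

lemma J1_lin: "clinear J1" and J2_lin: "clinear J2"
  and J1_iso: "cinner (J1 x) (J1 y) = cinner x y" and J2_iso: "cinner (J2 x) (J2 y) = cinner x y"
  and J1_J2: "cinner (J1 x) (J2 y) = 0" and J_range: "range (W_op J1 J2) = generic_space T lam"
  using W by (auto simp: unitary_sum_onto_def)

lemma J2_J1: "cinner (J2 x) (J1 y) = 0"
  using cinner_conj[of "J2 x" "J1 y"] by (simp add: J1_J2)

lemma J1_in: "J1 k \<in> generic_space T lam" and J2_in: "J2 k \<in> generic_space T lam"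
proof -
  have "W_op J1 J2 (k, 0) \<in> generic_space T lam" "W_op J1 J2 (0, k) \<in> generic_space T lam"
    using J_range by blast+
  then show "J1 k \<in> generic_space T lam" "J2 k \<in> generic_space T lam"
    by (simp_all add: W_op_def clinear_zero[OF J1_lin] clinear_zero[OF J2_lin])
qed

text \<open>The adjoints are found by projecting \<open>y\<close> onto the generic space and reading
  off its two coordinates; isometry and orthogonality of the embeddings confirm the adjoint
  identities.\<close>

lemma J1_adjoint: "cinner (J1 x) y = cinner x (A1 y)"
  and J2_adjoint: "cinner (J2 x) y = cinner x (A2 y)"
  and J_adjoint_proj: "J1 (A1 y) + J2 (A2 y) = orth_proj (generic_space T lam) y"
proof -
  let ?p = "orth_proj (generic_space T lam)"
  have sub: "csubspace (generic_space T lam)" and clo: "cclosed (generic_space T lam)"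
    unfolding generic_space_def by (rule csubspace_orth_compl cclosed_orth_compl)+
  have "\<exists>a b. ?p y = J1 a + J2 b" for y
  proof -
    have "?p y \<in> range (W_op J1 J2)" unfolding J_range by (rule orth_proj_in[OF sub clo])
    then show ?thesis by (auto simp: W_op_def)
  qed
  then obtain a b where ab: "\<And>y. ?p y = J1 (a y) + J2 (b y)" by metis
  have "cinner m y = cinner m (?p y)" if "m \<in> generic_space T lam" for m y
    using orth_proj_orth[OF sub clo that, of y] by (simp add: cinner_simps)
  note pr = this[OF J1_in] this[OF J2_in]
  have 1: "cinner (J1 x) y = cinner x (a y)" for x y
    unfolding pr(1)[of x y] ab by (simp add: cinner_simps J1_iso J1_J2)
  have 2: "cinner (J2 x) y = cinner x (b y)" for x y
    unfolding pr(2)[of x y] ab by (simp add: cinner_simps J2_iso J2_J1)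
  have "A1 = a" "A2 = b" by (rule adjoint_eqI, rule 1 2)+
  then show "cinner (J1 x) y = cinner x (A1 y)" "cinner (J2 x) y = cinner x (A2 y)"
    "J1 (A1 y) + J2 (A2 y) = ?p y"
    by (simp_all add: 1 2 ab)
qed

lemma J_adjoint_ident: "x \<in> generic_space T lam \<Longrightarrow> J1 (A1 x) + J2 (A2 x) = x"
  unfolding J_adjoint_proj
  by (rule orth_proj_ident) (simp_all add: generic_space_def csubspace_orth_compl)

lemma A_J: "A1 (J1 x) = x" "A1 (J2 x) = 0" "A2 (J1 x) = 0" "A2 (J2 x) = x"
  by (rule cinner_ext, simp add: J1_adjoint[symmetric] J2_adjoint[symmetric] J1_iso J2_iso J1_J2 J2_J1)+

lemma A1_sa: "cinner (A1 x) y = cinner x (J1 y)"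
  using J1_adjoint[of y x] cinner_conj[of "A1 x" y] cinner_conj[of x "J1 y"] by simp

lemma A2_sa: "cinner (A2 x) y = cinner x (J2 y)"
  using J2_adjoint[of y x] cinner_conj[of "A2 x" y] cinner_conj[of x "J2 y"] by simp

lemma J1_bounded: "bounded_op J1" and J2_bounded: "bounded_op J2"
  by (rule bounded_opI[of _ 1]; simp add: J1_lin J2_lin cnorm_def J1_iso J2_iso)+

lemma A1_bounded: "bounded_op A1"
proof (rule bounded_opI)
  show "clinear A1"
    unfolding clinear_def
    by (intro conjI allI; rule cinner_ext) (simp_all add: J1_adjoint[symmetric] cinner_simps)
  show "cnorm (A1 x) \<le> 1 * cnorm x" for x
  proof (cases "cnorm (A1 x) = 0")
    case False
    have "(cnorm (A1 x))\<^sup>2 \<le> cnorm (A1 x) * cnorm x"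
      using cinner_cauchy_schwarz[of "J1 (A1 x)" x] complex_Re_le_cmod[of "cinner (J1 (A1 x)) x"]
      by (simp add: J1_adjoint cnorm_sq) (simp add: cnorm_def J1_iso)
    then show ?thesis using False cnorm_ge_0[of "A1 x"] by (simp add: power2_eq_square)
  qed simp
qed

lemma A2_bounded: "bounded_op A2"
proof (rule bounded_opI)
  show "clinear A2"
    unfolding clinear_def
    by (intro conjI allI; rule cinner_ext) (simp_all add: J2_adjoint[symmetric] cinner_simps)
  show "cnorm (A2 x) \<le> 1 * cnorm x" for x
  proof (cases "cnorm (A2 x) = 0")
    case False
    have "(cnorm (A2 x))\<^sup>2 \<le> cnorm (A2 x) * cnorm x"
      using cinner_cauchy_schwarz[of "J2 (A2 x)" x] complex_Re_le_cmod[of "cinner (J2 (A2 x)) x"]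
      by (simp add: J2_adjoint cnorm_sq) (simp add: cnorm_def J2_iso)
    then show ?thesis using False cnorm_ge_0[of "A2 x"] by (simp add: power2_eq_square)
  qed simp
qed

lemmas J_lin = clinear_simps[OF J1_lin] clinear_simps[OF J2_lin]
lemmas A_lin = clinear_simps[OF bounded_op_clinear[OF A1_bounded]] clinear_simps[OF bounded_op_clinear[OF A2_bounded]]

lemma proj_J: "r \<in> eigs \<Longrightarrow> proj r (J1 x) = 0" "r \<in> eigs \<Longrightarrow> proj r (J2 x) = 0"
  using J1_in[of x] J2_in[of x] unfolding generic_space_iff
  by (auto intro!: orth_proj_orthogonal[OF eigenspace_subspace])

lemma A_eigenspace:
  assumes "r \<in> eigs" "m \<in> eigenspace r"
  shows "A1 m = 0" "A2 m = 0"
proof -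
  have "cinner m (J1 z) = 0" "cinner m (J2 z) = 0" for z
    using J1_in[of z] J2_in[of z] assms unfolding generic_space_iff by blast+
  then have "cinner (A1 m) z = 0" "cinner (A2 m) z = 0" for z by (simp_all add: A1_sa A2_sa)
  then show "A1 m = 0" "A2 m = 0" by (auto intro: cinner_eq_zero)
qed

section \<open>Splitting along the eigenspaces\<close>

definition eigpart :: "'a \<Rightarrow> 'a" where
  "eigpart x = (\<Sum>r\<in>eigs. proj r x)"

lemma A_eigpart: "A1 (eigpart x) = 0" "A2 (eigpart x) = 0"
proof -
  have "A1 (proj r x) = 0" "A2 (proj r x) = 0" if "r \<in> eigs" for r
    using A_eigenspace[OF that proj_in] by blast+
  then show "A1 (eigpart x) = 0" "A2 (eigpart x) = 0"
    unfolding eigpart_def clinear_sum[OF bounded_op_clinear[OF A1_bounded]]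
      clinear_sum[OF bounded_op_clinear[OF A2_bounded]] by simp_all
qed

text \<open>The eigenspaces are mutually orthogonal, so subtracting all their projections leaves a
  vector orthogonal to each of them, and the coordinates reproduce it.\<close>

lemma decomposition: "x = eigpart x + (J1 (A1 x) + J2 (A2 x))"
proof -
  have "x - eigpart x \<in> generic_space T lam"
    unfolding generic_space_iff
  proof (intro ballI)
    fix s m assume s: "s \<in> eigs" and m: "m \<in> eigenspace s"
    have "cinner m (proj r x) = (if r = s then cinner m x else 0)" for r
      using eigenspace_orth[OF _ m proj_in, of r x] proj_orth[OF m, of x] by (auto simp: cinner_simps)
    then have "cinner m (eigpart x) = (\<Sum>r\<in>eigs. if r = s then cinner m x else 0)"
      unfolding eigpart_def cinner_sum_right by (simp only:)
    also have "\<dots> = cinner m x" by (subst sum.delta) (use s in auto)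
    finally show "cinner m (x - eigpart x) = 0" by (simp add: cinner_simps)
  qed
  then have "J1 (A1 (x - eigpart x)) + J2 (A2 (x - eigpart x)) = x - eigpart x"
    by (rule J_adjoint_ident)
  then show ?thesis by (simp add: A_lin A_eigpart algebra_simps)
qed

text \<open>A self-adjoint idempotent 2 by 2 operator matrix is carried to the generic space by the
  embeddings and extended by zero, as \<open>A1\<close> and \<open>A2\<close> vanish on the
  eigenspaces.\<close>

lemma block_projection:
  assumes bdd: "bounded_op m11" "bounded_op m12" "bounded_op m21" "bounded_op m22"
    and sa: "\<And>x y. cinner (m11 x) y = cinner x (m11 y)" "\<And>x y. cinner (m22 x) y = cinner x (m22 y)"
      "\<And>x y. cinner (m12 x) y = cinner x (m21 y)"
    and idem: "\<And>x. m11 (m11 x) + m12 (m21 x) = m11 x" "\<And>x. m11 (m12 x) + m12 (m22 x) = m12 x"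
      "\<And>x. m21 (m11 x) + m22 (m21 x) = m21 x" "\<And>x. m21 (m12 x) + m22 (m22 x) = m22 x"
  shows "is_projection (\<lambda>x. J1 (m11 (A1 x) + m12 (A2 x)) + J2 (m21 (A1 x) + m22 (A2 x)))"
proof (rule is_projectionI)
  have A: "bounded_op (\<lambda>x. f (A1 x) + g (A2 x))" if "bounded_op f" "bounded_op g" for f g :: "'b \<Rightarrow> 'b"
    by (rule bounded_op_add[OF bounded_op_compose[OF that(1) A1_bounded] bounded_op_compose[OF that(2) A2_bounded]])
  show "bounded_op (\<lambda>x. J1 (m11 (A1 x) + m12 (A2 x)) + J2 (m21 (A1 x) + m22 (A2 x)))"
    by (rule bounded_op_add[OF bounded_op_compose[OF J1_bounded A[OF bdd(1,2)]]
          bounded_op_compose[OF J2_bounded A[OF bdd(3,4)]]])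
  have sa': "cinner (m21 x) y = cinner x (m12 y)" for x y
    using sa(3)[of y x] cinner_conj[of "m21 x" y] cinner_conj[of x "m12 y"] by simp
  show "cinner (J1 (m11 (A1 x) + m12 (A2 x)) + J2 (m21 (A1 x) + m22 (A2 x))) y
      = cinner x (J1 (m11 (A1 y) + m12 (A2 y)) + J2 (m21 (A1 y) + m22 (A2 y)))" for x y
    by (simp add: cinner_simps J1_adjoint J2_adjoint flip: A1_sa A2_sa) (simp add: cinner_simps sa sa')
  note lin = clinear_add[OF bounded_op_clinear[OF bdd(1)]] clinear_add[OF bounded_op_clinear[OF bdd(2)]]
    clinear_add[OF bounded_op_clinear[OF bdd(3)]] clinear_add[OF bounded_op_clinear[OF bdd(4)]]
  have 1: "m11 (m11 x + m12 y) + m12 (m21 x + m22 y) = m11 x + m12 y" for x y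
    using idem(1)[of x] idem(2)[of y] by (metis (no_types) lin(1,2) add.assoc add.left_commute)
  have 2: "m21 (m11 x + m12 y) + m22 (m21 x + m22 y) = m21 x + m22 y" for x y
    using idem(3)[of x] idem(4)[of y] by (metis (no_types) lin(3,4) add.assoc add.left_commute)
  show "J1 (m11 (A1 (J1 (m11 (A1 x) + m12 (A2 x)) + J2 (m21 (A1 x) + m22 (A2 x))))
      + m12 (A2 (J1 (m11 (A1 x) + m12 (A2 x)) + J2 (m21 (A1 x) + m22 (A2 x)))))
    + J2 (m21 (A1 (J1 (m11 (A1 x) + m12 (A2 x)) + J2 (m21 (A1 x) + m22 (A2 x))))
      + m22 (A2 (J1 (m11 (A1 x) + m12 (A2 x)) + J2 (m21 (A1 x) + m22 (A2 x)))))
    = J1 (m11 (A1 x) + m12 (A2 x)) + J2 (m21 (A1 x) + m22 (A2 x))" for x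
  proof -
    have "A1 (J1 u + J2 v) = u" "A2 (J1 u + J2 v) = v" for u v by (simp_all add: A_lin A_J)
    then show ?thesis by (simp only: 1 2)
  qed
qed

lemma T_decomposition:
  "T x = (\<Sum>r\<in>eigs. complex_of_real r *\<^sub>C proj r x)
    + (J1 (complex_of_real ((1 + lam) / 2) *\<^sub>C A1 x + B (A1 x))
     + J2 (complex_of_real ((1 + lam) / 2) *\<^sub>C A2 x - B (A2 x)))"
proof -
  have "T x = T (eigpart x) + (T (J1 (A1 x)) + T (J2 (A2 x)))"
    using arg_cong[OF decomposition[of x], of T] by (simp only: T_lin)
  also have "T (eigpart x) = (\<Sum>r\<in>eigs. complex_of_real r *\<^sub>C proj r x)"
    unfolding eigpart_def clinear_sum[OF bounded_op_clinear[OF T_bounded]] T_proj ..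
  finally show ?thesis by (simp only: T_J1 T_J2 J_lin)
qed

text \<open>\<open>E1\<close> and \<open>E2\<close> are the prescribed parts of \<open>P\<close> and
  \<open>Q\<close> on the eigenspaces; leaving them open lets both cases of the theorem share this
  direction.\<close>

lemma pair_of_unitary:
  assumes U: "unitary U" "U \<circ> B = B \<circ> U"
    and E: "is_projection E1" "\<And>x. E1 (J1 x) = 0" "\<And>x. E1 (J2 x) = 0"
      "is_projection E2" "\<And>x. E2 (J1 x) = 0" "\<And>x. E2 (J2 x) = 0"
    and sum: "\<And>x. (\<Sum>r\<in>eigs. complex_of_real r *\<^sub>C proj r x) = complex_of_real lam *\<^sub>C E1 x + E2 x"
  shows "((\<lambda>x. E1 x + W_op J1 J2 (P_U lam B U (W_adj J1 J2 x))),
          (\<lambda>x. E2 x + W_op J1 J2 (Q_U lam B U (W_adj J1 J2 x)))) \<in> T_pairs T lam"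
proof -
  have PW: "W_op J1 J2 (P_U lam B U (W_adj J1 J2 x)) =
      J1 (PU11 (A1 x) + PU12 U (A2 x)) + J2 (PU21 U (A1 x) + PU22 (A2 x))" for x
    by (simp only: W_adj_def P_U_eq[OF U] W_op_def prod.case)
  have QW: "W_op J1 J2 (Q_U lam B U (W_adj J1 J2 x)) =
      J1 (QU11 (A1 x) + QU12 U (A2 x)) + J2 (QU21 U (A1 x) + QU22 (A2 x))" for x
    by (simp only: W_adj_def Q_U_eq[OF U] W_op_def prod.case)
  have E_J: "E1 (J1 u + J2 v) = 0" "E2 (J1 u + J2 v) = 0" for u v
    by (simp_all add: E clinear_add[OF is_projection_clinear[OF E(1)]] clinear_add[OF is_projection_clinear[OF E(4)]])
  have projP: "is_projection (\<lambda>x. J1 (PU11 (A1 x) + PU12 U (A2 x)) + J2 (PU21 U (A1 x) + PU22 (A2 x)))"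
    by (rule block_projection[OF block_bounded(1-4)[OF U] block_sa(1-3)[OF U] PU_idempotent[OF U]])
  have projQ: "is_projection (\<lambda>x. J1 (QU11 (A1 x) + QU12 U (A2 x)) + J2 (QU21 U (A1 x) + QU22 (A2 x)))"
    by (rule block_projection[OF block_bounded(5-8)[OF U] block_sa(4-6)[OF U] QU_idempotent[OF U]])
  have "is_projection (\<lambda>x. E1 x + W_op J1 J2 (P_U lam B U (W_adj J1 J2 x)))"
    unfolding PW by (rule is_projection_add[OF E(1) projP]) (rule E_J)
  moreover have "is_projection (\<lambda>x. E2 x + W_op J1 J2 (Q_U lam B U (W_adj J1 J2 x)))"
    unfolding QW by (rule is_projection_add[OF E(4) projQ]) (rule E_J)
  moreover have "T x = complex_of_real lam *\<^sub>C (E1 x + W_op J1 J2 (P_U lam B U (W_adj J1 J2 x)))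
      + (E2 x + W_op J1 J2 (Q_U lam B U (W_adj J1 J2 x)))" for x
    unfolding PW QW T_decomposition[of x] sum block_sum[OF U, symmetric, of "A1 x" "A2 x"]
    \<comment> \<open>Turned around, the second equation mentions its lower coordinate first, hence
      the exchanged arguments.\<close>
    unfolding block_sum(2)[OF U, symmetric, of "A2 x" "A1 x"]
    by (simp only: J_lin scaleC_add_right ac_simps)
  ultimately show ?thesis unfolding T_pairs_def by (auto simp: fun_eq_iff)
qed

text \<open>The generic part can be treated separately only if \<open>P\<close> preserves the
  eigenspaces; \<open>inv\<close> records this, and it is verified differently for
  \<open>lam = 1\<close> and for other values. Then \<open>G\<close> acts on the generic space as a
  block matrix to which the solved block equations apply, and \<open>P\<close> and \<open>Q\<close>
  are recovered from \<open>S\<close> and \<open>G\<close>.\<close>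

lemma unitary_of_pair:
  assumes PQ: "(P, Q) \<in> T_pairs T lam"
    and inv: "\<And>r m. r \<in> eigs \<Longrightarrow> m \<in> eigenspace r \<Longrightarrow> P m \<in> eigenspace r"
  obtains U where "unitary U" "U \<circ> B = B \<circ> U"
    "\<And>x. P x = P (eigpart x) + W_op J1 J2 (P_U lam B U (W_adj J1 J2 x))"
    "\<And>x. Q x = Q (eigpart x) + W_op J1 J2 (Q_U lam B U (W_adj J1 J2 x))"
proof -
  have P: "is_projection P" and Q: "is_projection Q" and T_eq: "\<And>x. T x = complex_of_real lam *\<^sub>C P x + Q x"
    using PQ by (auto simp: T_pairs_def)
  note P_lin = clinear_simps[OF is_projection_clinear[OF P]]
  note Q_lin = clinear_simps[OF is_projection_clinear[OF Q]]
  note PP = is_projection_idem[OF P] note QQ = is_projection_idem[OF Q]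
  define c where "c = complex_of_real ((1 + lam) / 2)"
  define S where "S x = T x - c *\<^sub>C x" for x
  define G where "G x = complex_of_real (2 * lam) *\<^sub>C P x - complex_of_real lam *\<^sub>C x - S x" for x
  have S_bdd: "bounded_op S" unfolding S_def by (intro bounded_op_intros T_bounded)
  have G_bdd: "bounded_op G"
    unfolding G_def by (intro bounded_op_intros S_bdd is_projection_bounded[OF P])
  note S_lin = clinear_simps[OF bounded_op_clinear[OF S_bdd]]
  note G_lin = clinear_simps[OF bounded_op_clinear[OF G_bdd]]
  have G_sa: "cinner (G x) y = cinner x (G y)" for x y
    by (simp add: G_def S_def c_def cinner_simps T_sa is_projection_sa[OF P])
  have SG: "S (G x) + G (S x) = (2 * kap) *\<^sub>C x" for x
    by (rule cinner_ext)
      (simp add: G_def S_def c_def T_eq P_lin Q_lin PP QQ cinner_simps field_simps power2_eq_square)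
  have SS: "S (S x) + G (G x) = complex_of_real ((lam\<^sup>2 + 1) / 2) *\<^sub>C x" for x
    by (rule cinner_ext)
      (simp add: G_def S_def c_def T_eq P_lin Q_lin PP QQ cinner_simps field_simps power2_eq_square)
  have S_J: "S (J1 k) = J1 (B k)" "S (J2 k) = - J2 (B k)" for k
    by (simp_all add: S_def T_J1 T_J2 c_def)
  \<comment> \<open>A self-adjoint operator that preserves the eigenspaces preserves their
    orthogonal complement.\<close>
  have G_in: "G x \<in> generic_space T lam" if "x \<in> generic_space T lam" for x
    unfolding generic_space_iff
  proof (intro ballI)
    fix r m assume r: "r \<in> eigs" and m: "m \<in> eigenspace r"
    have "P m \<in> eigenspace r" using inv[OF r m] .
    then have "cinner m x = 0" "cinner (P m) x = 0" using that r m unfolding generic_space_iff by blast+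
    then show "cinner m (G x) = 0"
      using m by (simp add: G_def S_def cinner_simps eigenspace_iff flip: T_sa is_projection_sa[OF P])
  qed
  define g11 where "g11 x = A1 (G (J1 x))" for x
  define g12 where "g12 x = A1 (G (J2 x))" for x
  define g21 where "g21 x = A2 (G (J1 x))" for x
  define g22 where "g22 x = A2 (G (J2 x))" for x
  note g_defs = g11_def g12_def g21_def g22_def
  have G_J: "G (J1 x) = J1 (g11 x) + J2 (g21 x)" "G (J2 x) = J1 (g12 x) + J2 (g22 x)" for x
    using J_adjoint_ident[OF G_in[OF J1_in]] J_adjoint_ident[OF G_in[OF J2_in]] by (simp_all add: g_defs)
  have bdd: "bounded_op g11" "bounded_op g12" "bounded_op g21" "bounded_op g22"
    unfolding g_defs
    by (rule bounded_op_compose[OF A1_bounded bounded_op_compose[OF G_bdd J1_bounded]]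
        bounded_op_compose[OF A1_bounded bounded_op_compose[OF G_bdd J2_bounded]]
        bounded_op_compose[OF A2_bounded bounded_op_compose[OF G_bdd J1_bounded]]
        bounded_op_compose[OF A2_bounded bounded_op_compose[OF G_bdd J2_bounded]])+
  have adj: "cinner (g12 x) y = cinner x (g21 y)" for x y
    by (simp add: g_defs A1_sa G_sa flip: J2_adjoint)
  have SG1: "A1 (S (G (J1 x))) + A1 (G (S (J1 x))) = (2 * kap) *\<^sub>C x"
    "A2 (S (G (J1 x))) + A2 (G (S (J1 x))) = 0"
    "A1 (S (G (J2 x))) + A1 (G (S (J2 x))) = 0"
    "A2 (S (G (J2 x))) + A2 (G (S (J2 x))) = (2 * kap) *\<^sub>C x" for x
    using SG[of "J1 x", THEN arg_cong, of A1] SG[of "J1 x", THEN arg_cong, of A2]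
      SG[of "J2 x", THEN arg_cong, of A1] SG[of "J2 x", THEN arg_cong, of A2]
    by (simp_all only: A_lin A_J cv.scale_zero_right)
  have "B (g11 x) + g11 (B x) = A1 (S (G (J1 x))) + A1 (G (S (J1 x)))"
      "B (g22 x) + g22 (B x) = - (A2 (S (G (J2 x))) + A2 (G (S (J2 x))))"
      "g12 (B x) = B (g12 x)" "g21 (B x) = B (g21 x)" for x
    using SG1(2,3)[of x] by (simp_all add: G_J S_J S_lin G_lin A_lin A_J)
  note anti = this[unfolded SG1]
  have SS1: "A1 (S (S (J1 x))) + A1 (G (G (J1 x))) = complex_of_real ((lam\<^sup>2 + 1) / 2) *\<^sub>C x"
    "A2 (S (S (J2 x))) + A2 (G (G (J2 x))) = complex_of_real ((lam\<^sup>2 + 1) / 2) *\<^sub>C x" for x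
    using SS[of "J1 x", THEN arg_cong, of A1] SS[of "J2 x", THEN arg_cong, of A2]
    by (simp_all only: A_lin A_J)
  have "B (B x) + g11 (g11 x) + g12 (g21 x) = A1 (S (S (J1 x))) + A1 (G (G (J1 x)))"
      "B (B x) + g22 (g22 x) + g21 (g12 x) = A2 (S (S (J2 x))) + A2 (G (G (J2 x)))" for x
    by (simp_all add: G_J S_J S_lin G_lin A_lin A_J J_lin add.assoc add.commute)
  note sq = this[unfolded SS1]
  obtain U where U: "unitary U" "U \<circ> B = B \<circ> U" and g: "\<And>x. g11 x = F x" "\<And>x. g22 x = - F x"
    "\<And>x. g12 x = N (U x)" "\<And>x. g21 x = adjoint U (N x)"
    using block_solution[OF bdd adj anti sq] by metis
  have lam: "complex_of_real lam \<noteq> 0" using lam_ne by simp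
  have P_eq: "P x = complex_of_real (1 / (2 * lam)) *\<^sub>C (complex_of_real lam *\<^sub>C x + S x + G x)" for x
    by (rule cinner_ext) (use lam in \<open>simp add: G_def cinner_simps field_simps\<close>)
  have Q_eq: "Q x = complex_of_real (1 / 2) *\<^sub>C (x + S x - G x)" for x
    by (rule cinner_ext) (simp add: G_def S_def T_eq c_def cinner_simps field_simps)
  have PJ: "P (J1 a + J2 b) = J1 (PU11 a + PU12 U b) + J2 (PU21 U a + PU22 b)" for a b
    by (rule cinner_ext)
      (simp add: P_eq S_lin G_lin S_J G_J J_lin g cinner_simps algebra_simps)
  have QJ: "Q (J1 a + J2 b) = J1 (QU11 a + QU12 U b) + J2 (QU21 U a + QU22 b)" for a b
    by (rule cinner_ext)
      (simp add: Q_eq S_lin G_lin S_J G_J J_lin g cinner_simps algebra_simps)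
  have WP: "W_op J1 J2 (P_U lam B U (W_adj J1 J2 x)) = P (J1 (A1 x) + J2 (A2 x))"
    and WQ: "W_op J1 J2 (Q_U lam B U (W_adj J1 J2 x)) = Q (J1 (A1 x) + J2 (A2 x))" for x
    by (simp_all only: W_adj_def P_U_eq[OF U] Q_U_eq[OF U] W_op_def prod.case PJ QJ)
  show ?thesis
  proof (rule that[OF U])
    show "P x = P (eigpart x) + W_op J1 J2 (P_U lam B U (W_adj J1 J2 x))" for x
      unfolding WP P_lin(1)[symmetric] decomposition[symmetric] ..
    show "Q x = Q (eigpart x) + W_op J1 J2 (Q_U lam B U (W_adj J1 J2 x))" for x
      unfolding WQ Q_lin(1)[symmetric] decomposition[symmetric] ..
  qed
qed

section \<open>Projections inside a single eigenspace\<close>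

lemma projection_proj_compose:
  assumes P: "is_projection P" and inv: "\<And>m. m \<in> eigenspace r \<Longrightarrow> P m \<in> eigenspace r"
  shows "is_projection (\<lambda>x. P (proj r x))"
proof (rule is_projectionI)
  have fixed: "proj r (P (proj r x)) = P (proj r x)" for x
    by (rule proj_ident[OF inv[OF proj_in]])
  show "bounded_op (\<lambda>x. P (proj r x))"
    by (rule bounded_op_compose[OF is_projection_bounded[OF P] is_projection_bounded[OF proj_projection]])
  show "cinner (P (proj r x)) y = cinner x (P (proj r y))" for x y
  proof -
    have "cinner (proj r (P (proj r x))) y = cinner x (proj r (P (proj r y)))"
      by (simp only: is_projection_sa[OF proj_projection] is_projection_sa[OF P])
    then show ?thesis by (simp only: fixed)
  qed
  show "P (proj r (P (proj r x))) = P (proj r x)" for x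
    by (simp only: fixed is_projection_idem[OF P])
qed

lemma eigenspace_projection_zero:
  assumes E: "is_projection E" "range E \<subseteq> eigenspace r" and orth: "\<And>m. m \<in> eigenspace r \<Longrightarrow> cinner m x = 0"
  shows "E x = 0"
proof (rule cinner_ext)
  show "cinner z (E x) = cinner z 0" for z
    using orth[of "E z"] E(2) is_projection_sa[OF E(1), of z x] by auto
qed

text \<open>\<open>E\<close> and \<open>1 - proj r\<close> are orthogonal projections with product
  zero; the difference is the complement of their sum.\<close>

lemma is_projection_proj_diff:
  assumes E: "is_projection E" "range E \<subseteq> eigenspace r"
  shows "is_projection (\<lambda>x. proj r x - E x)"
proof -
  have "is_projection (\<lambda>x. E x + (x - proj r x))"
    by (rule is_projection_add[OF E(1) is_projection_complement[OF proj_projection]])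
      (rule eigenspace_projection_zero[OF E proj_orth])
  from is_projection_complement[OF this] show ?thesis by (simp add: algebra_simps)
qed

text \<open>On the eigenspace for 1 the relation reads \<open>P + Q = 1\<close>, which leaves
  \<open>P\<close> free there: this is the parameter \<open>E\<close>. On the eigenspaces for 0 and
  2 both projections are forced.\<close>

lemma T_pairs_if_one:
  assumes lam: "lam = 1"
  shows "T_pairs T lam =
    {((\<lambda>x. E x + proj 2 x + W_op J1 J2 (P_U lam B U (W_adj J1 J2 x))),
      (\<lambda>x. (proj 1 x - E x) + proj 2 x + W_op J1 J2 (Q_U lam B U (W_adj J1 J2 x))))
     | E U. is_projection E \<and> range E \<subseteq> eigenspace 1 \<and> unitary U \<and> U \<circ> B = B \<circ> U}"
    (is "_ = ?R")
proof (intro set_eqI iffI)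
  have eigs: "eigs = {0, 1, 2}" using lam by auto
  fix PQ
  {
    assume PQ_in: "PQ \<in> T_pairs T lam"
    obtain P Q where PQ: "PQ = (P, Q)" by (cases PQ)
    have P: "is_projection P" and Q: "is_projection Q" and T_eq: "\<And>x. T x = P x + Q x"
      using PQ_in lam by (auto simp: T_pairs_def PQ)
    note P_lin = clinear_simps[OF is_projection_clinear[OF P]]
    note Q_lin = clinear_simps[OF is_projection_clinear[OF Q]]
    have 0: "P m = 0" "Q m = 0" if "m \<in> eigenspace 0" for m
      using that projection_combination_zero_left[OF P Q, of 1 m]
        projection_combination_zero_right[OF P Q, of 1 m] by (simp_all add: eigenspace_iff T_eq)
    have 2: "P m = m" "Q m = m" if "m \<in> eigenspace 2" for m
    proof -
      have "P m + Q m = m + m"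
        using that cv.scale_left_distrib[of 1 1 m] by (simp add: eigenspace_iff T_eq)
      \<comment> \<open>Passing to the complements turns the top eigenvalue into a vanishing
        combination with \<open>mu = 1\<close>.\<close>
      then have "complex_of_real 1 *\<^sub>C (m - P m) + (m - Q m) = 0" by (simp add: algebra_simps)
      then have "m - P m = 0" "m - Q m = 0"
        using projection_combination_zero_left[OF is_projection_complement[OF P] is_projection_complement[OF Q], of 1]
          projection_combination_zero_right[OF is_projection_complement[OF P] is_projection_complement[OF Q], of 1]
        by simp_all
      then show "P m = m" "Q m = m" by simp_all
    qed
    have 1: "P m \<in> eigenspace 1" "Q m = m - P m" if "m \<in> eigenspace 1" for m
    proof -
      have m: "P m + Q m = m" using that by (simp add: eigenspace_iff T_eq)
      then show Qm: "Q m = m - P m" by (simp add: eq_diff_eq add.commute)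
      \<comment> \<open>\<open>P m\<close> is fixed by \<open>P\<close> and annihilated by
        \<open>Q\<close>, so \<open>T\<close> fixes it.\<close>
      have "Q (P m) = Q (m - Q m)" using Qm by simp
      then have "Q (P m) = 0" by (simp add: Q_lin is_projection_idem[OF Q])
      then show "P m \<in> eigenspace 1" by (simp add: eigenspace_iff T_eq is_projection_idem[OF P])
    qed
    have "P m \<in> eigenspace r" if "r \<in> eigs" "m \<in> eigenspace r" for r m
      using that 0 1 2 unfolding eigs by (auto simp: eigenspace_iff T_lin)
    then obtain U where U: "unitary U" "U \<circ> B = B \<circ> U"
      "\<And>x. P x = P (eigpart x) + W_op J1 J2 (P_U lam B U (W_adj J1 J2 x))"
      "\<And>x. Q x = Q (eigpart x) + W_op J1 J2 (Q_U lam B U (W_adj J1 J2 x))"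
      using unitary_of_pair[OF PQ_in[unfolded PQ]] by metis
    define E where "E x = P (proj 1 x)" for x
    have E: "is_projection E" "range E \<subseteq> eigenspace 1"
      unfolding E_def using projection_proj_compose[OF P 1(1)] 1(1) proj_in by auto
    have eigpart: "eigpart x = proj 0 x + (proj 1 x + proj 2 x)" for x
      unfolding eigpart_def eigs by simp
    have "P (eigpart x) = E x + proj 2 x" "Q (eigpart x) = (proj 1 x - E x) + proj 2 x" for x
      unfolding eigpart P_lin Q_lin E_def
      using 0[OF proj_in] 1(2)[OF proj_in] 2[OF proj_in] by simp_all
    then have "P = (\<lambda>x. E x + proj 2 x + W_op J1 J2 (P_U lam B U (W_adj J1 J2 x)))"
      "Q = (\<lambda>x. (proj 1 x - E x) + proj 2 x + W_op J1 J2 (Q_U lam B U (W_adj J1 J2 x)))"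
      using U(3,4) by (metis ext)+
    then show "PQ \<in> ?R" unfolding PQ using E U(1,2) by blast
  next
    assume "PQ \<in> ?R"
    then obtain E U where PQ: "PQ = ((\<lambda>x. E x + proj 2 x + W_op J1 J2 (P_U lam B U (W_adj J1 J2 x))),
        (\<lambda>x. (proj 1 x - E x) + proj 2 x + W_op J1 J2 (Q_U lam B U (W_adj J1 J2 x))))"
      and E: "is_projection E" "range E \<subseteq> eigenspace 1" and U: "unitary U" "U \<circ> B = B \<circ> U"
      by blast
    have E2: "E (proj 2 x) = 0" for x
      by (rule eigenspace_projection_zero[OF E]) (rule eigenspace_orth[OF _ _ proj_in], simp_all)
    have E_J: "E (J1 x) = 0" "E (J2 x) = 0" for x
      by (rule eigenspace_projection_zero[OF E], use J1_in[of x] J2_in[of x] in \<open>simp add: generic_space_iff\<close>)+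
    have two: "2 \<in> eigs" "1 \<in> eigs" unfolding eigs by simp_all
    note proj_J' = proj_J[OF two(1)] proj_J[OF two(2)]
    show "PQ \<in> T_pairs T lam"
      unfolding PQ
    proof (rule pair_of_unitary[OF U])
      show "is_projection (\<lambda>x. E x + proj 2 x)"
        by (rule is_projection_add[OF E(1) proj_projection E2])
      show "is_projection (\<lambda>x. proj 1 x - E x + proj 2 x)"
        by (rule is_projection_add[OF is_projection_proj_diff[OF E] proj_projection])
          (simp add: E2 proj_proj)
      show "(\<Sum>r\<in>eigs. complex_of_real r *\<^sub>C proj r x)
          = complex_of_real lam *\<^sub>C (E x + proj 2 x) + (proj 1 x - E x + proj 2 x)" for x
        unfolding eigs using cv.scale_left_distrib[of 1 1 "proj 2 x"] by (simp add: lam)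
    qed (simp_all add: E_J proj_J')
  }
qed

text \<open>On each eigenspace, replacing \<open>P\<close>, \<open>Q\<close>, both or neither by
  complements gives a vanishing combination with \<open>mu = lam\<close> or
  \<open>mu = - lam\<close>. As \<open>lam\<close> is none of 0, 1 and -1, \<open>mu\<close> is
  neither 0 nor -1, so \<open>P\<close> and \<open>Q\<close> are forced to be 0 or the identity and
  only \<open>U\<close> remains free.\<close>

lemma T_pairs_if_not_one:
  assumes lam: "lam \<noteq> 1"
  shows "T_pairs T lam =
    {((\<lambda>x. proj lam x + proj (1 + lam) x + W_op J1 J2 (P_U lam B U (W_adj J1 J2 x))),
      (\<lambda>x. proj 1 x + proj (1 + lam) x + W_op J1 J2 (Q_U lam B U (W_adj J1 J2 x))))
     | U. unitary U \<and> U \<circ> B = B \<circ> U}"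
    (is "_ = ?R")
proof (intro set_eqI iffI)
  have distinct: "lam \<noteq> 0" "lam \<noteq> 1" "lam \<noteq> -1" "1 + lam \<noteq> 0" "- lam \<noteq> -1" "- lam \<noteq> 0"
    using lam lam_ne by (auto simp: add_eq_0_iff)
  have sum: "(\<Sum>r\<in>eigs. f r) = f 0 + (f 1 + (f lam + f (1 + lam)))" for f :: "real \<Rightarrow> 'a"
    using distinct by simp
  fix PQ
  {
    assume PQ_in: "PQ \<in> T_pairs T lam"
    obtain P Q where PQ: "PQ = (P, Q)" by (cases PQ)
    have P: "is_projection P" and Q: "is_projection Q" and T_eq: "\<And>x. T x = complex_of_real lam *\<^sub>C P x + Q x"
      using PQ_in by (auto simp: T_pairs_def PQ)
    note P_lin = clinear_simps[OF is_projection_clinear[OF P]]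
    note Q_lin = clinear_simps[OF is_projection_clinear[OF Q]]
    note P' = is_projection_complement[OF P] and Q' = is_projection_complement[OF Q]
    have 0: "P m = 0" "Q m = 0" if "m \<in> eigenspace 0" for m
      using that projection_combination_zero_left[OF P Q distinct(1,3), of m]
        projection_combination_zero_right[OF P Q distinct(1,3), of m] by (simp_all add: eigenspace_iff T_eq)
    have 1: "P m = 0" "Q m = m" if "m \<in> eigenspace 1" for m
    proof -
      have "complex_of_real lam *\<^sub>C P m + Q m = m" using that by (simp add: eigenspace_iff T_eq)
      then have eq: "complex_of_real (- lam) *\<^sub>C P m + (m - Q m) = 0" by (simp add: algebra_simps)
      show "P m = 0" by (rule projection_combination_zero_left[OF P Q' distinct(6,5) eq])
      show "Q m = m" using projection_combination_zero_right[OF P Q' distinct(6,5) eq] by simp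
    qed
    have 2: "P m = m" "Q m = 0" if "m \<in> eigenspace lam" for m
    proof -
      have "complex_of_real lam *\<^sub>C P m + Q m = complex_of_real lam *\<^sub>C m" using that by (simp add: eigenspace_iff T_eq)
      then have eq: "complex_of_real (- lam) *\<^sub>C (m - P m) + Q m = 0"
        by (simp add: cv.scale_right_diff_distrib algebra_simps)
      show "P m = m" using projection_combination_zero_left[OF P' Q distinct(6,5) eq] by simp
      show "Q m = 0" by (rule projection_combination_zero_right[OF P' Q distinct(6,5) eq])
    qed
    have 3: "P m = m" "Q m = m" if "m \<in> eigenspace (1 + lam)" for m
    proof -
      have "complex_of_real lam *\<^sub>C P m + Q m = m + complex_of_real lam *\<^sub>C m"
        using that by (simp add: eigenspace_iff T_eq scaleC_add_left)
      then have eq: "complex_of_real lam *\<^sub>C (m - P m) + (m - Q m) = 0"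
        by (simp add: cv.scale_right_diff_distrib algebra_simps)
      show "P m = m" using projection_combination_zero_left[OF P' Q' distinct(1,3) eq] by simp
      show "Q m = m" using projection_combination_zero_right[OF P' Q' distinct(1,3) eq] by simp
    qed
    have "P m \<in> eigenspace r" if "r \<in> eigs" "m \<in> eigenspace r" for r m
    proof -
      have "P m = 0 \<or> P m = m" using that 0 1 2 3 by blast
      moreover have "0 \<in> eigenspace r" by (simp add: eigenspace_iff T_lin)
      ultimately show ?thesis using that(2) by metis
    qed
    then obtain U where U: "unitary U" "U \<circ> B = B \<circ> U"
      "\<And>x. P x = P (eigpart x) + W_op J1 J2 (P_U lam B U (W_adj J1 J2 x))"
      "\<And>x. Q x = Q (eigpart x) + W_op J1 J2 (Q_U lam B U (W_adj J1 J2 x))"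
      using unitary_of_pair[OF PQ_in[unfolded PQ]] by metis
    have "P (eigpart x) = proj lam x + proj (1 + lam) x" "Q (eigpart x) = proj 1 x + proj (1 + lam) x" for x
      unfolding eigpart_def sum P_lin Q_lin
      using 0[OF proj_in] 1[OF proj_in] 2[OF proj_in] 3[OF proj_in] by simp_all
    then have "P = (\<lambda>x. proj lam x + proj (1 + lam) x + W_op J1 J2 (P_U lam B U (W_adj J1 J2 x)))"
      "Q = (\<lambda>x. proj 1 x + proj (1 + lam) x + W_op J1 J2 (Q_U lam B U (W_adj J1 J2 x)))"
      using U(3,4) by (metis ext)+
    then show "PQ \<in> ?R" unfolding PQ using U(1,2) by blast
  next
    assume "PQ \<in> ?R"
    then obtain U where PQ: "PQ = ((\<lambda>x. proj lam x + proj (1 + lam) x + W_op J1 J2 (P_U lam B U (W_adj J1 J2 x))),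
        (\<lambda>x. proj 1 x + proj (1 + lam) x + W_op J1 J2 (Q_U lam B U (W_adj J1 J2 x))))"
      and U: "unitary U" "U \<circ> B = B \<circ> U"
      by blast
    show "PQ \<in> T_pairs T lam"
      unfolding PQ
    proof (rule pair_of_unitary[OF U])
      show "is_projection (\<lambda>x. proj lam x + proj (1 + lam) x)"
        "is_projection (\<lambda>x. proj 1 x + proj (1 + lam) x)"
        using distinct by (auto intro!: is_projection_add proj_projection proj_proj)
      show "(\<Sum>r\<in>eigs. complex_of_real r *\<^sub>C proj r x)
          = complex_of_real lam *\<^sub>C (proj lam x + proj (1 + lam) x) + (proj 1 x + proj (1 + lam) x)" for x
        unfolding sum by (simp add: scaleC_add_left scaleC_add_right algebra_simps)
    qed (simp_all add: proj_J)
  }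
qed

lemma pair_exists: "\<exists>P Q. (P, Q) \<in> T_pairs T lam"
proof -
  have id: "unitary (\<lambda>x::'b. x)" "(\<lambda>x. x) \<circ> B = B \<circ> (\<lambda>x. x)"
    by (auto simp: unitary_def)
  have zero: "is_projection (\<lambda>x::'a. 0)" "range (\<lambda>x::'a. 0 :: 'a) \<subseteq> eigenspace 1"
    by (simp_all add: is_projectionI eigenspace_iff T_lin image_subset_iff)
  show ?thesis
  proof (cases "lam = 1")
    case True
    show ?thesis
      unfolding T_pairs_if_one[OF True]
      by (rule exI, rule exI, rule CollectI, rule exI[of _ "\<lambda>x. 0"], rule exI[of _ "\<lambda>x. x"])
        (rule conjI, rule refl, intro conjI zero id)
  next
    case False
    show ?thesis
      unfolding T_pairs_if_not_one[OF False]
      by (rule exI, rule exI, rule CollectI, rule exI[of _ "\<lambda>x. x"]) (rule conjI, rule refl, intro conjI id)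
  qed
qed

end

theorem theorem2p6:
  fixes T :: "'a::chilbert_space \<Rightarrow> 'a" and lam :: real
    and B :: "'b::chilbert_space \<Rightarrow> 'b" and J1 J2 :: "'b \<Rightarrow> 'a"
  assumes inf_dim: "infinite_dimensional TYPE('a)"
    and lam_ne: "lam \<noteq> -1" "lam \<noteq> 0"
    and T_sa: "selfadjoint T"
    and W: "unitary_sum_onto J1 J2 (generic_space T lam)"
    and T0_1: "\<forall>k. T (J1 k) - complex_of_real ((1 + lam) / 2) *\<^sub>C J1 k = J1 (B k)"
    and T0_2: "\<forall>k. T (J2 k) - complex_of_real ((1 + lam) / 2) *\<^sub>C J2 k = J2 (- B k)"
    and B_pos: "positive_op B"
    and B_lower: "op_less (scal_op (\<bar>1 - \<bar>lam\<bar>\<bar> / 2)) B"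
    and B_upper: "op_less B (scal_op ((1 + \<bar>lam\<bar>) / 2))"
  shows "(\<exists>P Q. is_projection P \<and> is_projection Q \<and>
                 T = (\<lambda>x. complex_of_real lam *\<^sub>C P x + Q x))
    \<and> (lam = 1 \<longrightarrow>
         T_pairs T lam =
           {((\<lambda>x. E x + orth_proj (kernel (shift T 2)) x
                     + W_op J1 J2 (P_U lam B U (W_adj J1 J2 x))),
             (\<lambda>x. (orth_proj (kernel (shift T 1)) x - E x) + orth_proj (kernel (shift T 2)) x
                     + W_op J1 J2 (Q_U lam B U (W_adj J1 J2 x))))
            | E U. is_projection E \<and> range E \<subseteq> kernel (shift T 1)
                   \<and> unitary U \<and> U \<circ> B = B \<circ> U})
    \<and> (lam \<notin> {-1, 0, 1} \<longrightarrow>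
         T_pairs T lam =
           {((\<lambda>x. orth_proj (kernel (shift T lam)) x + orth_proj (kernel (shift T (1 + lam))) x
                     + W_op J1 J2 (P_U lam B U (W_adj J1 J2 x))),
             (\<lambda>x. orth_proj (kernel (shift T 1)) x + orth_proj (kernel (shift T (1 + lam))) x
                     + W_op J1 J2 (Q_U lam B U (W_adj J1 J2 x))))
            | U. unitary U \<and> U \<circ> B = B \<circ> U})"
proof -
  interpret generic_decomposition lam B T J1 J2
  proof unfold_locales
    show "T (J1 k) = complex_of_real ((1 + lam) / 2) *\<^sub>C J1 k + J1 (B k)" for k
      using T0_1 by (metis add.commute diff_add_cancel)
    have "clinear J2" using W by (simp add: unitary_sum_onto_def)
    then show "T (J2 k) = complex_of_real ((1 + lam) / 2) *\<^sub>C J2 k - J2 (B k)" for k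
      using T0_2[rule_format, of k] by (simp add: clinear_minus diff_eq_eq)
  qed (use assms in auto)
  show ?thesis
  proof (intro conjI impI)
    show "\<exists>P Q. is_projection P \<and> is_projection Q \<and> T = (\<lambda>x. complex_of_real lam *\<^sub>C P x + Q x)"
      using pair_exists by (simp add: T_pairs_def)
  qed (rule T_pairs_if_one T_pairs_if_not_one; simp)+
qed

end
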